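(* Let $A=(B,C^s,C^t,\mathcal{B})$ be a dynamic contact algebra. Then there exist a full standard dynamic contact algebra $\mathbb{B}=(\prod_{i\in T}B_i,C^s,C^t,\mathcal{B})$ over some time structure $(T,\prec)$ and contact algebras $(B_i,C_i)$, $i\in T$, and an isomorphic embedding $h$ of $A$ into $\mathbb{B}$. Moreover, for each axiom $\alpha$ from the list (rs), (ls), (up dir), (down dir), (circ), (dens), (ref), (lin), (tri), (tr), $\alpha$ holds in $A$ iff $\alpha$ holds in $\mathbb{B}$.
   Context: A precontact relation on a Boolean algebra $(B,0,1,\le,+,\cdot,{}^* )$ is a binary relation $C$ with: $aCb\Rightarrow a\neq0,b\neq0$; $aCb$, $a\le a'$, $b\le b'\Rightarrow a'Cb'$; $aC(b+c)\Rightarrow aCb$ or $aCc$; $(a+b)Cc\Rightarrow aCc$ or $bCc$. A contact relation is a symmetric precontact relation with $a\cdot b\neq0\Rightarrow aCb$; a contact algebra is a Boolean algebra with a contact relation. $\overline{C}$ is the complement of $C$. A dynamic contact algebra (DCA) is $(B,C^s,C^t,\mathcal{B})$ with $B$ a Boolean algebra with $0\neq1$, $C^s,C^t$ contact relations, $\mathcal{B}$ a precontact relation, such that: $aC^sb\Rightarrow aC^tb$; $a\overline{C^t}b\Rightarrow\exists c\,(a\overline{C^t}c$ and $c^*\overline{C^t}b)$; $a\overline{\mathcal{B}}b\Rightarrow\exists c\,(a\overline{C^t}c$ and $c^*\overline{\mathcal{B}}b)$; $a\overline{\mathcal{B}}b\Rightarrow\exists c\,(a\overline{\mathcal{B}}c$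 and $c^*\overline{C^t}b)$. A full standard DCA: given a set $T$ with binary relation $\prec$ and contact algebras $(B_i,C_i)$, $i\in T$, take the product Boolean algebra $\prod_{i\in T}B_i$ with coordinatewise operations and relations $aC^sb$ iff $\exists m\,(a_mC_mb_m)$; $aC^tb$ iff $\exists m\,(a_m\neq0_m$ and $b_m\neq0_m)$; $a\mathcal{B}b$ iff $\exists m,n\,(m\prec n$, $a_m\neq0_m$, $b_n\neq0_n)$. An isomorphic embedding of DCAs is an injective Boolean homomorphism $h$ with $aRb\iff h(a)Rh(b)$ for each of $R=C^s,C^t,\mathcal{B}$. Time axioms (variables universally quantified): (rs) $a\neq0\Rightarrow a\mathcal{B}1$; (ls) $a\neq0\Rightarrow 1\mathcal{B}a$; (up dir) $a\neq0,b\neq0\Rightarrow a\mathcal{B}p$ or $b\mathcal{B}p^*$; (down dir) $a\neq0,b\neq0\Rightarrow p\mathcal{B}a$ or $p^*\mathcal{B}b$; (circ) $a\mathcal{B}b\Rightarrow b\mathcal{B}p$ or $p^*\mathcal{B}a$; (dens) $a\mathcal{B}b\Rightarrow a\mathcal{B}p$ or $p^*\mathcal{B}b$; (ref) $aC^tb\Rightarrow a\mathcal{B}b$; (lin) $a\neq0,b\neq0\Rightarrow a\mathcal{B}b$ or $b\mathcal{B}a$; (tri) $a\neq0,b\neq0\Rightarrow aC^tb$ or $a\mathcal{B}b$ or $b\mathcal{B}a$; (tr) $a\overline{\mathcal{B}}b\Rightarrow\exists c\,(a\overline{\mathcal{B}}c$ and $c^*\overline{\mathcal{B}}b)$. *)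

theory Defs
  imports "HOL-Library.FuncSet" "HOL-Algebra.Congruence"
begin

text \<open>
  The factors of a product may be Boolean algebras of different sizes, so the type class
  \<open>boolean_algebra\<close> does not fit. A Boolean algebra is a record with an explicit carrier;
  its axioms are those of the locale \<^locale>\<open>abstract_boolean_algebra\<close>, relativised to
  the carrier. The degenerate algebra is not excluded at this level.
\<close>

record 'a bool_alg = "'a partial_object" +
  bzero :: 'a ("\<^bold>0\<index>")
  bone :: 'a ("\<^bold>1\<index>")
  bjoin :: "'a \<Rightarrow> 'a \<Rightarrow> 'a" (infixl "\<^bold>+\<index>" 65)
  bmeet :: "'a \<Rightarrow> 'a \<Rightarrow> 'a" (infixl "\<^bold>\<cdot>\<index>" 70)
  bcompl :: "'a \<Rightarrow> 'a" ("\<^bold>-\<index> _" [81] 80)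

locale boolean_alg =
  fixes A (structure)
  assumes zero_closed: "\<^bold>0 \<in> carrier A"
    and one_closed: "\<^bold>1 \<in> carrier A"
    and join_closed: "\<lbrakk>a \<in> carrier A; b \<in> carrier A\<rbrakk> \<Longrightarrow> a \<^bold>+ b \<in> carrier A"
    and meet_closed: "\<lbrakk>a \<in> carrier A; b \<in> carrier A\<rbrakk> \<Longrightarrow> a \<^bold>\<cdot> b \<in> carrier A"
    and compl_closed: "a \<in> carrier A \<Longrightarrow> \<^bold>- a \<in> carrier A"
    and join_assoc: "\<lbrakk>a \<in> carrier A; b \<in> carrier A; c \<in> carrier A\<rbrakk>
      \<Longrightarrow> (a \<^bold>+ b) \<^bold>+ c = a \<^bold>+ (b \<^bold>+ c)"
    and meet_assoc: "\<lbrakk>a \<in> carrier A; b \<in> carrier A; c \<in> carrier A\<rbrakk>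
      \<Longrightarrow> (a \<^bold>\<cdot> b) \<^bold>\<cdot> c = a \<^bold>\<cdot> (b \<^bold>\<cdot> c)"
    and join_comm: "\<lbrakk>a \<in> carrier A; b \<in> carrier A\<rbrakk> \<Longrightarrow> a \<^bold>+ b = b \<^bold>+ a"
    and meet_comm: "\<lbrakk>a \<in> carrier A; b \<in> carrier A\<rbrakk> \<Longrightarrow> a \<^bold>\<cdot> b = b \<^bold>\<cdot> a"
    and meet_join_distrib: "\<lbrakk>a \<in> carrier A; b \<in> carrier A; c \<in> carrier A\<rbrakk>
      \<Longrightarrow> a \<^bold>\<cdot> (b \<^bold>+ c) = (a \<^bold>\<cdot> b) \<^bold>+ (a \<^bold>\<cdot> c)"
    and join_meet_distrib: "\<lbrakk>a \<in> carrier A; b \<in> carrier A; c \<in> carrier A\<rbrakk>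
      \<Longrightarrow> a \<^bold>+ (b \<^bold>\<cdot> c) = (a \<^bold>+ b) \<^bold>\<cdot> (a \<^bold>+ c)"
    and join_zero: "a \<in> carrier A \<Longrightarrow> a \<^bold>+ \<^bold>0 = a"
    and meet_one: "a \<in> carrier A \<Longrightarrow> a \<^bold>\<cdot> \<^bold>1 = a"
    and join_compl: "a \<in> carrier A \<Longrightarrow> a \<^bold>+ (\<^bold>- a) = \<^bold>1"
    and meet_compl: "a \<in> carrier A \<Longrightarrow> a \<^bold>\<cdot> (\<^bold>- a) = \<^bold>0"

definition ble :: "('a, 'm) bool_alg_scheme \<Rightarrow> 'a \<Rightarrow> 'a \<Rightarrow> bool" (infix "\<^bold>\<le>\<index>" 50)
  where "a \<^bold>\<le>\<^bsub>A\<^esub> b \<longleftrightarrow> a \<^bold>\<cdot>\<^bsub>A\<^esub> b = a"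

text \<open>Only the values of a relation on the carrier matter, here and below.\<close>

locale precontact_algebra = boolean_alg A for A (structure) +
  fixes C :: "'a \<Rightarrow> 'a \<Rightarrow> bool"
  assumes nonzero: "\<lbrakk>a \<in> carrier A; b \<in> carrier A; C a b\<rbrakk> \<Longrightarrow> a \<noteq> \<^bold>0 \<and> b \<noteq> \<^bold>0"
    and upward: "\<lbrakk>a \<in> carrier A; b \<in> carrier A; a' \<in> carrier A; b' \<in> carrier A;
      C a b; a \<^bold>\<le> a'; b \<^bold>\<le> b'\<rbrakk> \<Longrightarrow> C a' b'"
    and right_additive: "\<lbrakk>a \<in> carrier A; b \<in> carrier A; c \<in> carrier A; C a (b \<^bold>+ c)\<rbrakk>
      \<Longrightarrow> C a b \<or> C a c"
    and left_additive: "\<lbrakk>a \<in> carrier A; b \<in> carrier A; c \<in> carrier A; C (a \<^bold>+ b) c\<rbrakk>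
      \<Longrightarrow> C a c \<or> C b c"

locale contact_algebra = precontact_algebra +
  assumes symmetric: "\<lbrakk>a \<in> carrier A; b \<in> carrier A; C a b\<rbrakk> \<Longrightarrow> C b a"
    and overlap: "\<lbrakk>a \<in> carrier A; b \<in> carrier A; a \<^bold>\<cdot> b \<noteq> \<^bold>0\<rbrakk> \<Longrightarrow> C a b"

record 'a dca = "'a bool_alg" +
  space_contact :: "'a \<Rightarrow> 'a \<Rightarrow> bool" ("C\<^sup>s\<index>")
  time_contact :: "'a \<Rightarrow> 'a \<Rightarrow> bool" ("C\<^sup>t\<index>")
  precedence :: "'a \<Rightarrow> 'a \<Rightarrow> bool" ("\<B>\<index>")

locale dynamic_contact_algebra =
  boolean_alg A + space: contact_algebra A "C\<^sup>s\<^bsub>A\<^esub>" + time: contact_algebra A "C\<^sup>t\<^bsub>A\<^esub>" +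
  prec: precontact_algebra A "\<B>\<^bsub>A\<^esub>"
  for A (structure) +
  assumes nondegenerate: "\<^bold>0 \<noteq> \<^bold>1"
    and space_imp_time: "\<lbrakk>a \<in> carrier A; b \<in> carrier A; C\<^sup>s a b\<rbrakk> \<Longrightarrow> C\<^sup>t a b"
    and time_efremovich: "\<lbrakk>a \<in> carrier A; b \<in> carrier A; \<not> C\<^sup>t a b\<rbrakk>
      \<Longrightarrow> \<exists>c\<in>carrier A. \<not> C\<^sup>t a c \<and> \<not> C\<^sup>t (\<^bold>- c) b"
    and time_prec: "\<lbrakk>a \<in> carrier A; b \<in> carrier A; \<not> \<B> a b\<rbrakk>
      \<Longrightarrow> \<exists>c\<in>carrier A. \<not> C\<^sup>t a c \<and> \<not> \<B> (\<^bold>- c) b"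
    and prec_time: "\<lbrakk>a \<in> carrier A; b \<in> carrier A; \<not> \<B> a b\<rbrakk>
      \<Longrightarrow> \<exists>c\<in>carrier A. \<not> \<B> a c \<and> \<not> C\<^sup>t (\<^bold>- c) b"

definition full_standard_dca ::
    "'i set \<Rightarrow> ('i \<Rightarrow> 'i \<Rightarrow> bool) \<Rightarrow> ('i \<Rightarrow> ('b, 'm) bool_alg_scheme) \<Rightarrow>
     ('i \<Rightarrow> 'b \<Rightarrow> 'b \<Rightarrow> bool) \<Rightarrow> ('i \<Rightarrow> 'b) dca"
  where "full_standard_dca T before Bs Cs =
    \<lparr> carrier = (\<Pi>\<^sub>E i\<in>T. carrier (Bs i)),
      bzero = (\<lambda>i\<in>T. \<^bold>0\<^bsub>Bs i\<^esub>),
      bone = (\<lambda>i\<in>T. \<^bold>1\<^bsub>Bs i\<^esub>),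
      bjoin = (\<lambda>a b. \<lambda>i\<in>T. a i \<^bold>+\<^bsub>Bs i\<^esub> b i),
      bmeet = (\<lambda>a b. \<lambda>i\<in>T. a i \<^bold>\<cdot>\<^bsub>Bs i\<^esub> b i),
      bcompl = (\<lambda>a. \<lambda>i\<in>T. \<^bold>-\<^bsub>Bs i\<^esub> a i),
      space_contact = (\<lambda>a b. \<exists>m\<in>T. Cs m (a m) (b m)),
      time_contact = (\<lambda>a b. \<exists>m\<in>T. a m \<noteq> \<^bold>0\<^bsub>Bs m\<^esub> \<and> b m \<noteq> \<^bold>0\<^bsub>Bs m\<^esub>),
      precedence = (\<lambda>a b. \<exists>m\<in>T. \<exists>n\<in>T. before m n \<and> a m \<noteq> \<^bold>0\<^bsub>Bs m\<^esub> \<and> b n \<noteq> \<^bold>0\<^bsub>Bs n\<^esub>) \<rparr>"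

definition boolean_hom ::
    "('a \<Rightarrow> 'b) \<Rightarrow> ('a, 'm) bool_alg_scheme \<Rightarrow> ('b, 'n) bool_alg_scheme \<Rightarrow> bool"
  where "boolean_hom h A D \<longleftrightarrow>
    h \<in> carrier A \<rightarrow> carrier D \<and>
    h \<^bold>0\<^bsub>A\<^esub> = \<^bold>0\<^bsub>D\<^esub> \<and> h \<^bold>1\<^bsub>A\<^esub> = \<^bold>1\<^bsub>D\<^esub> \<and>
    (\<forall>a\<in>carrier A. \<forall>b\<in>carrier A. h (a \<^bold>+\<^bsub>A\<^esub> b) = h a \<^bold>+\<^bsub>D\<^esub> h b) \<and>
    (\<forall>a\<in>carrier A. \<forall>b\<in>carrier A. h (a \<^bold>\<cdot>\<^bsub>A\<^esub> b) = h a \<^bold>\<cdot>\<^bsub>D\<^esub> h b) \<and>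
    (\<forall>a\<in>carrier A. h (\<^bold>-\<^bsub>A\<^esub> a) = \<^bold>-\<^bsub>D\<^esub> h a)"

definition dca_embedding ::
    "('a \<Rightarrow> 'b) \<Rightarrow> ('a, 'm) dca_scheme \<Rightarrow> ('b, 'n) dca_scheme \<Rightarrow> bool"
  where "dca_embedding h A D \<longleftrightarrow>
    boolean_hom h A D \<and> inj_on h (carrier A) \<and>
    (\<forall>a\<in>carrier A. \<forall>b\<in>carrier A.
      (C\<^sup>s\<^bsub>A\<^esub> a b \<longleftrightarrow> C\<^sup>s\<^bsub>D\<^esub> (h a) (h b)) \<and>
      (C\<^sup>t\<^bsub>A\<^esub> a b \<longleftrightarrow> C\<^sup>t\<^bsub>D\<^esub> (h a) (h b)) \<and>
      (\<B>\<^bsub>A\<^esub> a b \<longleftrightarrow> \<B>\<^bsub>D\<^esub> (h a) (h b)))"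

datatype time_axiom = RS | LS | UpDir | DownDir | Circ | Dens | Ref | Lin | Tri | Tr

primrec holds_in :: "time_axiom \<Rightarrow> ('a, 'm) dca_scheme \<Rightarrow> bool" where
  "holds_in RS A \<longleftrightarrow> (\<forall>a\<in>carrier A. a \<noteq> \<^bold>0\<^bsub>A\<^esub> \<longrightarrow> \<B>\<^bsub>A\<^esub> a \<^bold>1\<^bsub>A\<^esub>)"
| "holds_in LS A \<longleftrightarrow> (\<forall>a\<in>carrier A. a \<noteq> \<^bold>0\<^bsub>A\<^esub> \<longrightarrow> \<B>\<^bsub>A\<^esub> \<^bold>1\<^bsub>A\<^esub> a)"
| "holds_in UpDir A \<longleftrightarrow> (\<forall>a\<in>carrier A. \<forall>b\<in>carrier A. \<forall>p\<in>carrier A.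
     a \<noteq> \<^bold>0\<^bsub>A\<^esub> \<and> b \<noteq> \<^bold>0\<^bsub>A\<^esub> \<longrightarrow> \<B>\<^bsub>A\<^esub> a p \<or> \<B>\<^bsub>A\<^esub> b (\<^bold>-\<^bsub>A\<^esub> p))"
| "holds_in DownDir A \<longleftrightarrow> (\<forall>a\<in>carrier A. \<forall>b\<in>carrier A. \<forall>p\<in>carrier A.
     a \<noteq> \<^bold>0\<^bsub>A\<^esub> \<and> b \<noteq> \<^bold>0\<^bsub>A\<^esub> \<longrightarrow> \<B>\<^bsub>A\<^esub> p a \<or> \<B>\<^bsub>A\<^esub> (\<^bold>-\<^bsub>A\<^esub> p) b)"
| "holds_in Circ A \<longleftrightarrow> (\<forall>a\<in>carrier A. \<forall>b\<in>carrier A. \<forall>p\<in>carrier A.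
     \<B>\<^bsub>A\<^esub> a b \<longrightarrow> \<B>\<^bsub>A\<^esub> b p \<or> \<B>\<^bsub>A\<^esub> (\<^bold>-\<^bsub>A\<^esub> p) a)"
| "holds_in Dens A \<longleftrightarrow> (\<forall>a\<in>carrier A. \<forall>b\<in>carrier A. \<forall>p\<in>carrier A.
     \<B>\<^bsub>A\<^esub> a b \<longrightarrow> \<B>\<^bsub>A\<^esub> a p \<or> \<B>\<^bsub>A\<^esub> (\<^bold>-\<^bsub>A\<^esub> p) b)"
| "holds_in Ref A \<longleftrightarrow> (\<forall>a\<in>carrier A. \<forall>b\<in>carrier A. C\<^sup>t\<^bsub>A\<^esub> a b \<longrightarrow> \<B>\<^bsub>A\<^esub> a b)"
| "holds_in Lin A \<longleftrightarrow> (\<forall>a\<in>carrier A. \<forall>b\<in>carrier A.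
     a \<noteq> \<^bold>0\<^bsub>A\<^esub> \<and> b \<noteq> \<^bold>0\<^bsub>A\<^esub> \<longrightarrow> \<B>\<^bsub>A\<^esub> a b \<or> \<B>\<^bsub>A\<^esub> b a)"
| "holds_in Tri A \<longleftrightarrow> (\<forall>a\<in>carrier A. \<forall>b\<in>carrier A.
     a \<noteq> \<^bold>0\<^bsub>A\<^esub> \<and> b \<noteq> \<^bold>0\<^bsub>A\<^esub> \<longrightarrow> C\<^sup>t\<^bsub>A\<^esub> a b \<or> \<B>\<^bsub>A\<^esub> a b \<or> \<B>\<^bsub>A\<^esub> b a)"
| "holds_in Tr A \<longleftrightarrow> (\<forall>a\<in>carrier A. \<forall>b\<in>carrier A.
     \<not> \<B>\<^bsub>A\<^esub> a b \<longrightarrow> (\<exists>c\<in>carrier A. \<not> \<B>\<^bsub>A\<^esub> a c \<and> \<not> \<B>\<^bsub>A\<^esub> (\<^bold>-\<^bsub>A\<^esub> c) b))"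

end

theory Submission imports Defs begin

text \<open>
  The instants of the standard algebra are the clusters, i.e. the unions of the classes of
  ultrafilters under the equivalence \<open>U \<times> V \<subseteq> C\<^sup>t\<close>. A cluster precedes another one if
  \<open>\<Gamma> \<times> \<Delta> \<subseteq> \<B>\<close>, and by the two mixed Efremovich axioms this depends on one ultrafilter from each
  cluster only. The factor at \<open>\<Gamma>\<close> is the quotient by the ideal of the elements outside \<open>\<Gamma>\<close>, with
  the contact that the ultrafilters inside \<open>\<Gamma>\<close> induce.

  If \<open>C\<close> and \<open>D\<close> are precontact relations and \<open>F\<close> and \<open>G\<close> are closed under meets, then
  \<open>{b. \<exists>a\<in>F. \<not> C a b}\<close> and \<open>{b. \<exists>a\<in>G. \<not> D a b}\<close> are ideals, and some ultrafilter avoids both of them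
  unless they contain complementary elements. With the precedence, its converse or the overlap for
  \<open>C\<close> and \<open>D\<close> this single criterion represents precontact relations by ultrafilters and turns each
  existential time axiom into the corresponding property of the precedence between clusters.
\<close>

section \<open>Ultrafilters of a Boolean algebra\<close>

context boolean_alg
begin

lemmas closed [simp, intro] = zero_closed one_closed join_closed meet_closed compl_closed

lemma zero_join [simp]: "a \<in> carrier A \<Longrightarrow> \<^bold>0 \<^bold>+ a = a"
  using join_comm join_zero by auto

lemma one_meet [simp]: "a \<in> carrier A \<Longrightarrow> \<^bold>1 \<^bold>\<cdot> a = a"
  using meet_comm meet_one by auto

lemma meet_zero [simp]: assumes "a \<in> carrier A" shows "a \<^bold>\<cdot> \<^bold>0 = \<^bold>0"
  using assms meet_join_distrib[of a "\<^bold>0" "\<^bold>- a"] by (simp add: meet_compl join_zero)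

lemma zero_meet [simp]: "a \<in> carrier A \<Longrightarrow> \<^bold>0 \<^bold>\<cdot> a = \<^bold>0"
  using meet_comm meet_zero by auto

lemma join_one [simp]: assumes "a \<in> carrier A" shows "a \<^bold>+ \<^bold>1 = \<^bold>1"
  using assms join_meet_distrib[of a "\<^bold>1" "\<^bold>- a"] by (simp add: join_compl meet_one)

lemma meet_idem [simp]: assumes "a \<in> carrier A" shows "a \<^bold>\<cdot> a = a"
  using assms meet_join_distrib[of a a "\<^bold>- a"] by (simp add: meet_compl meet_one join_compl join_zero)

lemma join_meet_distrib_right:
  assumes "a \<in> carrier A" "b \<in> carrier A" "c \<in> carrier A"
  shows "(a \<^bold>+ b) \<^bold>\<cdot> c = (a \<^bold>\<cdot> c) \<^bold>+ (b \<^bold>\<cdot> c)"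
  using assms by (simp add: meet_comm[of _ c] meet_join_distrib)

lemma join_meet_absorb: assumes "a \<in> carrier A" "b \<in> carrier A" shows "(a \<^bold>+ b) \<^bold>\<cdot> a = a"
  using assms join_meet_distrib[of a "\<^bold>0" b] by (simp add: join_zero meet_comm[of "a \<^bold>+ b"])

lemma meet_left_commute:
  assumes "a \<in> carrier A" "b \<in> carrier A" "c \<in> carrier A"
  shows "a \<^bold>\<cdot> (b \<^bold>\<cdot> c) = b \<^bold>\<cdot> (a \<^bold>\<cdot> c)"
  using assms by (metis meet_assoc meet_comm)

lemma join_left_commute:
  assumes "a \<in> carrier A" "b \<in> carrier A" "c \<in> carrier A"
  shows "a \<^bold>+ (b \<^bold>+ c) = b \<^bold>+ (a \<^bold>+ c)"
  using assms by (metis join_assoc join_comm)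

lemma meet_left_idem: "\<lbrakk>a \<in> carrier A; b \<in> carrier A\<rbrakk> \<Longrightarrow> a \<^bold>\<cdot> (a \<^bold>\<cdot> b) = a \<^bold>\<cdot> b"
  by (simp flip: meet_assoc)

lemmas meet_ac = meet_assoc meet_comm meet_left_commute
lemmas join_ac = join_assoc join_comm join_left_commute

lemma compl_meet_self: "a \<in> carrier A \<Longrightarrow> \<^bold>- a \<^bold>\<cdot> a = \<^bold>0"
  using meet_comm meet_compl by auto

lemma compl_one [simp]: "\<^bold>- \<^bold>1 = \<^bold>0"
  using meet_compl[of "\<^bold>1"] by simp

lemma meet_leI: "\<lbrakk>a \<in> carrier A; b \<in> carrier A\<rbrakk> \<Longrightarrow> a \<^bold>\<cdot> b \<^bold>\<le> a" "\<lbrakk>a \<in> carrier A; b \<in> carrier A\<rbrakk> \<Longrightarrow> a \<^bold>\<cdot> b \<^bold>\<le> b"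
  by (auto simp: ble_def meet_ac meet_left_idem)

section \<open>Ideals and their sums\<close>

definition ideal :: "'a set \<Rightarrow> bool"
  where "ideal I \<longleftrightarrow> I \<subseteq> carrier A \<and> \<^bold>0 \<in> I \<and> (\<forall>a\<in>I. \<forall>b\<in>I. a \<^bold>+ b \<in> I) \<and>
    (\<forall>a\<in>I. \<forall>b\<in>carrier A. a \<^bold>\<cdot> b \<in> I)"

lemma idealD:
  assumes "ideal I"
  shows ideal_zero: "\<^bold>0 \<in> I"
    and ideal_join: "\<lbrakk>a \<in> I; b \<in> I\<rbrakk> \<Longrightarrow> a \<^bold>+ b \<in> I"
    and ideal_meet: "\<lbrakk>a \<in> I; b \<in> carrier A\<rbrakk> \<Longrightarrow> a \<^bold>\<cdot> b \<in> I"
  using assms by (auto simp: ideal_def)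

definition ideal_sum :: "'a set \<Rightarrow> 'a set \<Rightarrow> 'a set"
  where "ideal_sum I J = {x. \<exists>i\<in>I. \<exists>j\<in>J. x = i \<^bold>+ j}"

lemma ideal_ideal_sum:
  assumes I: "ideal I" and J: "ideal J"
  shows "ideal (ideal_sum I J)"
proof -
  have cl: "I \<subseteq> carrier A" "J \<subseteq> carrier A" using I J by (auto simp: ideal_def)
  have sum: "(i \<^bold>+ j) \<^bold>+ (i' \<^bold>+ j') = (i \<^bold>+ i') \<^bold>+ (j \<^bold>+ j')"
    if "i \<in> I" "j \<in> J" "i' \<in> I" "j' \<in> J" for i j i' j'
    using that cl by (simp add: join_ac subset_iff)
  have prod: "(i \<^bold>+ j) \<^bold>\<cdot> b = i \<^bold>\<cdot> b \<^bold>+ j \<^bold>\<cdot> b" if "i \<in> I" "j \<in> J" "b \<in> carrier A" for i j b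
    using that cl by (intro join_meet_distrib_right) auto
  show ?thesis
    unfolding ideal_def ideal_sum_def
  proof (intro conjI ballI)
    show "{x. \<exists>i\<in>I. \<exists>j\<in>J. x = i \<^bold>+ j} \<subseteq> carrier A" using cl by auto
    show "\<^bold>0 \<in> {x. \<exists>i\<in>I. \<exists>j\<in>J. x = i \<^bold>+ j}"
      using I J join_zero[of "\<^bold>0"] unfolding ideal_def by (intro CollectI bexI[of _ "\<^bold>0"]) auto
  next
    fix a b assume "a \<in> {x. \<exists>i\<in>I. \<exists>j\<in>J. x = i \<^bold>+ j}" "b \<in> {x. \<exists>i\<in>I. \<exists>j\<in>J. x = i \<^bold>+ j}"
    then obtain i j i' j' where ij: "i \<in> I" "j \<in> J" "i' \<in> I" "j' \<in> J"
      and "a = i \<^bold>+ j" "b = i' \<^bold>+ j'" by blast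
    then have "a \<^bold>+ b = (i \<^bold>+ i') \<^bold>+ (j \<^bold>+ j')" by (simp add: sum)
    moreover have "i \<^bold>+ i' \<in> I" "j \<^bold>+ j' \<in> J" using I J ij by (simp_all add: ideal_def)
    ultimately show "a \<^bold>+ b \<in> {x. \<exists>i\<in>I. \<exists>j\<in>J. x = i \<^bold>+ j}" by blast
  next
    fix a b assume "a \<in> {x. \<exists>i\<in>I. \<exists>j\<in>J. x = i \<^bold>+ j}" "b \<in> carrier A"
    then obtain i j where ij: "i \<in> I" "j \<in> J" and "a = i \<^bold>+ j" by blast
    then have "a \<^bold>\<cdot> b = i \<^bold>\<cdot> b \<^bold>+ j \<^bold>\<cdot> b" using \<open>b \<in> carrier A\<close> by (simp add: prod)
    moreover have "i \<^bold>\<cdot> b \<in> I" "j \<^bold>\<cdot> b \<in> J"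
      using I J ij \<open>b \<in> carrier A\<close> by (simp_all add: ideal_def)
    ultimately show "a \<^bold>\<cdot> b \<in> {x. \<exists>i\<in>I. \<exists>j\<in>J. x = i \<^bold>+ j}" by blast
  qed
qed

lemma subset_ideal_sum:
  assumes "ideal I" "ideal J"
  shows "I \<subseteq> ideal_sum I J" "J \<subseteq> ideal_sum I J"
proof -
  have cl: "\<And>x. x \<in> I \<Longrightarrow> x \<in> carrier A" "\<And>x. x \<in> J \<Longrightarrow> x \<in> carrier A"
    and 0: "\<^bold>0 \<in> I" "\<^bold>0 \<in> J" using assms by (auto simp: ideal_def)
  show "I \<subseteq> ideal_sum I J"
  proof
    fix x assume "x \<in> I"
    then show "x \<in> ideal_sum I J"
      unfolding ideal_sum_def using 0 cl join_zero by (intro CollectI bexI[of _ x] bexI[of _ "\<^bold>0"]) auto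
  qed
  show "J \<subseteq> ideal_sum I J"
  proof
    fix x assume "x \<in> J"
    then show "x \<in> ideal_sum I J"
      unfolding ideal_sum_def using 0 cl by (intro CollectI bexI[of _ "\<^bold>0"] bexI[of _ x]) auto
  qed
qed

text \<open>If the unit is the join of \<open>i\<close> and \<open>j\<close>, meeting with the
  complement of \<open>i\<close> shows that complement to lie below \<open>j\<close>, hence in
  \<open>J\<close>. Improperness of a sum thus becomes a pair of complementary elements.\<close>

lemma one_in_ideal_sum:
  assumes I: "ideal I" and J: "ideal J" and "\<^bold>1 \<in> ideal_sum I J"
  shows "\<exists>p\<in>I. \<^bold>- p \<in> J"
proof -
  obtain i j where ij: "i \<in> I" "j \<in> J" "\<^bold>1 = i \<^bold>+ j" using assms(3) by (auto simp: ideal_sum_def)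
  then have cl: "i \<in> carrier A" "j \<in> carrier A" using I J by (auto simp: ideal_def)
  have "\<^bold>- i = \<^bold>- i \<^bold>\<cdot> (i \<^bold>+ j)" using cl by (simp add: meet_one flip: ij(3))
  also have "\<dots> = j \<^bold>\<cdot> \<^bold>- i"
    using cl by (simp add: meet_join_distrib compl_meet_self meet_comm[of "\<^bold>- i" j])
  finally have "\<^bold>- i \<in> J" using ideal_meet[OF J ij(2), of "\<^bold>- i"] cl by simp
  then show ?thesis using ij(1) by blast
qed

section \<open>Ultrafilters and the prime ideal theorem\<close>

definition ultrafilter :: "'a set \<Rightarrow> bool"
  where "ultrafilter U \<longleftrightarrow> U \<subseteq> carrier A \<and> \<^bold>0 \<notin> U \<and>
    (\<forall>a\<in>carrier A. \<forall>b\<in>carrier A. a \<^bold>+ b \<in> U \<longleftrightarrow> a \<in> U \<or> b \<in> U) \<and>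
    (\<forall>a\<in>carrier A. \<^bold>- a \<in> U \<longleftrightarrow> a \<notin> U)"

lemma ultrafilter_closed: "\<lbrakk>ultrafilter U; a \<in> U\<rbrakk> \<Longrightarrow> a \<in> carrier A"
  by (auto simp: ultrafilter_def)

text \<open>By definition the characteristic function of \<open>U\<close> respects zero, joins and
  complements. The unit and meets follow, so it is a homomorphism to the two-element
  algebra.\<close>

lemma ultrafilter_simps [simp]:
  assumes "ultrafilter U"
  shows "\<^bold>0 \<notin> U" "\<^bold>1 \<in> U"
    "a \<in> carrier A \<Longrightarrow> \<^bold>- a \<in> U \<longleftrightarrow> a \<notin> U"
    "\<lbrakk>a \<in> carrier A; b \<in> carrier A\<rbrakk> \<Longrightarrow> a \<^bold>+ b \<in> U \<longleftrightarrow> a \<in> U \<or> b \<in> U"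
    "\<lbrakk>a \<in> carrier A; b \<in> carrier A\<rbrakk> \<Longrightarrow> a \<^bold>\<cdot> b \<in> U \<longleftrightarrow> a \<in> U \<and> b \<in> U"
proof -
  show zero: "\<^bold>0 \<notin> U" and compl: "\<And>a. a \<in> carrier A \<Longrightarrow> \<^bold>- a \<in> U \<longleftrightarrow> a \<notin> U"
    and join: "\<And>a b. \<lbrakk>a \<in> carrier A; b \<in> carrier A\<rbrakk> \<Longrightarrow> a \<^bold>+ b \<in> U \<longleftrightarrow> a \<in> U \<or> b \<in> U"
    using assms by (auto simp: ultrafilter_def)
  show "\<^bold>1 \<in> U" using compl[of "\<^bold>0"] join[of "\<^bold>0" "\<^bold>- \<^bold>0"] zero join_compl by auto
  have lower: "a \<in> U" if "a \<^bold>\<cdot> b \<in> U" "a \<in> carrier A" "b \<in> carrier A" for a b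
  proof -
    have "a \<^bold>+ a \<^bold>\<cdot> b = a \<^bold>\<cdot> (\<^bold>1 \<^bold>+ b)" using that by (simp add: meet_join_distrib meet_one)
    also have "\<dots> = a" using that by (simp add: join_comm[of "\<^bold>1"] meet_one)
    finally show ?thesis using join[of a "a \<^bold>\<cdot> b"] that by simp
  qed
  \<comment> \<open>\<open>a\<close> splits into its meets with \<open>b\<close> and with the
    complement of \<open>b\<close>. The second part cannot lie in \<open>U\<close>, since the
    complement of \<open>b\<close> would then do so too.\<close>
  have meet: "a \<^bold>\<cdot> b \<in> U" if "a \<in> U" "b \<in> U" "a \<in> carrier A" "b \<in> carrier A" for a b
  proof -
    have "a \<^bold>\<cdot> b \<^bold>+ a \<^bold>\<cdot> \<^bold>- b = a"
      using that by (simp add: join_compl meet_one flip: meet_join_distrib)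
    then have "a \<^bold>\<cdot> b \<in> U \<or> a \<^bold>\<cdot> \<^bold>- b \<in> U" using that join[of "a \<^bold>\<cdot> b" "a \<^bold>\<cdot> \<^bold>- b"] by simp
    moreover have "a \<^bold>\<cdot> \<^bold>- b \<notin> U"
      using lower[of "\<^bold>- b" a] that compl[of b] by (auto simp: meet_comm)
    ultimately show ?thesis by simp
  qed
  show "\<lbrakk>a \<in> carrier A; b \<in> carrier A\<rbrakk> \<Longrightarrow> a \<^bold>\<cdot> b \<in> U \<longleftrightarrow> a \<in> U \<and> b \<in> U"
    using lower[of a b] lower[of b a] meet[of a b] meet_comm[of a b] by auto
qed

text \<open>Zorn's lemma extends \<open>I\<close> to an ideal \<open>M\<close> that is maximal among
  those without the unit. Maximality makes \<open>M\<close> prime, so the rest of the carrier is an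
  ultrafilter.\<close>

lemma ultrafilter_avoiding_ideal:
  assumes I: "ideal I" and proper: "\<^bold>1 \<notin> I"
  shows "\<exists>U. ultrafilter U \<and> U \<inter> I = {}"
proof -
  let ?S = "{J. ideal J \<and> I \<subseteq> J \<and> \<^bold>1 \<notin> J}"
  have "\<exists>M\<in>?S. \<forall>J\<in>?S. M \<subseteq> J \<longrightarrow> J = M"
  proof (rule subset_Zorn_nonempty)
    show "?S \<noteq> {}" using assms by blast
  next
    fix \<C> assume ne: "\<C> \<noteq> {}" and ch: "subset.chain ?S \<C>"
    then have id: "ideal J" "I \<subseteq> J" "\<^bold>1 \<notin> J" if "J \<in> \<C>" for J
      using that unfolding subset_chain_def by blast+
    have "ideal (\<Union>\<C>)"
      unfolding ideal_def
    proof (intro conjI ballI)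
      fix a b assume "a \<in> \<Union>\<C>" "b \<in> \<Union>\<C>"
      then obtain J K where JK: "J \<in> \<C>" "K \<in> \<C>" "a \<in> J" "b \<in> K" by blast
      have "J \<subseteq> K \<or> K \<subseteq> J" using ch JK(1,2) unfolding subset_chain_def by blast
      then obtain L where L: "L \<in> \<C>" "a \<in> L" "b \<in> L" using JK by blast
      then have "a \<^bold>+ b \<in> L" using id unfolding ideal_def by blast
      then show "a \<^bold>+ b \<in> \<Union>\<C>" using L(1) by blast
    next
      show "\<Union>\<C> \<subseteq> carrier A" using id unfolding ideal_def by blast
      show "\<^bold>0 \<in> \<Union>\<C>" using ne id unfolding ideal_def by blast
    next
      fix a b assume "a \<in> \<Union>\<C>" "b \<in> carrier A"
      then obtain L where L: "L \<in> \<C>" "a \<in> L" by blast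
      then have "a \<^bold>\<cdot> b \<in> L" using id \<open>b \<in> carrier A\<close> unfolding ideal_def by blast
      then show "a \<^bold>\<cdot> b \<in> \<Union>\<C>" using L(1) by blast
    qed
    then show "\<Union>\<C> \<in> ?S" using ne id by blast
  qed
  then obtain M where "M \<in> ?S" and m: "\<forall>J\<in>?S. M \<subseteq> J \<longrightarrow> J = M" by (rule bexE)
  then have M: "ideal M" "I \<subseteq> M" "\<^bold>1 \<notin> M" by simp_all
  have max: "J = M" if "ideal J" "M \<subseteq> J" "\<^bold>1 \<notin> J" for J
    using m that M(2) by simp
  have cl: "M \<subseteq> carrier A" using M(1) by (simp add: ideal_def)
  have comp: "\<^bold>- a \<in> M \<longleftrightarrow> a \<notin> M" if a: "a \<in> carrier A" for a
  proof
    show "a \<notin> M" if "\<^bold>- a \<in> M"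
      using that M(3) join_compl[OF a] ideal_join[OF M(1)] by metis
  next
    assume "a \<notin> M"
    \<comment> \<open>The principal ideal of \<open>a\<close>. As \<open>a\<close> is outside
      \<open>M\<close>, the sum of \<open>M\<close> and \<open>?P\<close> is strictly larger than
      \<open>M\<close> and so contains the unit.\<close>
    let ?P = "{a \<^bold>\<cdot> x | x. x \<in> carrier A}"
    have P: "ideal ?P"
      unfolding ideal_def
    proof (intro conjI ballI)
      show "?P \<subseteq> carrier A" using a by auto
      show "\<^bold>0 \<in> ?P" using a by (intro CollectI exI[of _ "\<^bold>0"]) simp
    next
      fix x y assume "x \<in> ?P" "y \<in> ?P"
      then obtain u v where "x = a \<^bold>\<cdot> u" "u \<in> carrier A" "y = a \<^bold>\<cdot> v" "v \<in> carrier A" by auto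
      then show "x \<^bold>+ y \<in> ?P"
        using a by (intro CollectI exI[of _ "u \<^bold>+ v"]) (simp add: meet_join_distrib)
    next
      fix x y assume "x \<in> ?P" "y \<in> carrier A"
      then obtain u where "x = a \<^bold>\<cdot> u" "u \<in> carrier A" by auto
      then show "x \<^bold>\<cdot> y \<in> ?P"
        using a \<open>y \<in> carrier A\<close> by (intro CollectI exI[of _ "u \<^bold>\<cdot> y"]) (simp add: meet_assoc)
    qed
    have "a \<in> ?P" using a by (intro CollectI exI[of _ "\<^bold>1"]) (simp add: meet_one)
    then have "ideal_sum M ?P \<noteq> M" using \<open>a \<notin> M\<close> subset_ideal_sum[OF M(1) P] by blast
    then have "\<^bold>1 \<in> ideal_sum M ?P"
      using max[OF ideal_ideal_sum[OF M(1) P] subset_ideal_sum(1)[OF M(1) P]] by blast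
    \<comment> \<open>The complement of \<open>p\<close> lies below \<open>a\<close>, so the
      complement of \<open>a\<close> lies below \<open>p\<close>, as the calculation below
      confirms.\<close>
    then obtain p where p: "p \<in> M" "\<^bold>- p \<in> ?P" using one_in_ideal_sum[OF M(1) P] by blast
    then obtain x where x: "x \<in> carrier A" "\<^bold>- p = a \<^bold>\<cdot> x" by blast
    have pc: "p \<in> carrier A" using p cl by blast
    have "\<^bold>- a \<^bold>\<cdot> \<^bold>- p = (\<^bold>- a \<^bold>\<cdot> a) \<^bold>\<cdot> x"
      unfolding x(2) using a x(1) by (intro meet_assoc[symmetric]) auto
    also have "\<dots> = \<^bold>0" using a x(1) by (simp add: compl_meet_self)
    finally have "p \<^bold>\<cdot> \<^bold>- a = \<^bold>- a \<^bold>\<cdot> p \<^bold>+ \<^bold>- a \<^bold>\<cdot> \<^bold>- p"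
      using a pc by (simp add: join_zero meet_comm[of p])
    also have "\<dots> = \<^bold>- a \<^bold>\<cdot> (p \<^bold>+ \<^bold>- p)" using a pc by (intro meet_join_distrib[symmetric]) auto
    also have "\<dots> = \<^bold>- a" using a pc by (simp add: join_compl meet_one)
    finally have "p \<^bold>\<cdot> \<^bold>- a = \<^bold>- a" .
    then show "\<^bold>- a \<in> M" using ideal_meet[OF M(1) p(1), of "\<^bold>- a"] a by simp
  qed
  have join: "a \<^bold>+ b \<in> M \<longleftrightarrow> a \<in> M \<and> b \<in> M" if "a \<in> carrier A" "b \<in> carrier A" for a b
    using that ideal_join[OF M(1), of a b] ideal_meet[OF M(1), of "a \<^bold>+ b" a]
      ideal_meet[OF M(1), of "a \<^bold>+ b" b]
      join_meet_absorb[of a b] join_meet_absorb[of b a]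
    by (auto simp only: join_comm[of b a])
  have "ultrafilter (carrier A - M)"
    by (simp add: ultrafilter_def comp join ideal_zero[OF M(1)])
  then show ?thesis using M(2) by (intro exI[of _ "carrier A - M"]) auto
qed

text \<open>General enough for ultrafilters and singletons alike: one criterion then extends
  elements to ultrafilters and links ultrafilters that are already given.\<close>

definition meet_base :: "'a set \<Rightarrow> bool"
  where "meet_base F \<longleftrightarrow> F \<noteq> {} \<and> F \<subseteq> carrier A \<and> (\<forall>a\<in>F. \<forall>b\<in>F. a \<^bold>\<cdot> b \<in> F)"

lemma ultrafilter_meet_base: "ultrafilter U \<Longrightarrow> meet_base U"
  unfolding meet_base_def using ultrafilter_closed ultrafilter_simps(2,5) by blast

lemma singleton_meet_base: "a \<in> carrier A \<Longrightarrow> meet_base {a}"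
  by (simp add: meet_base_def)

end

section \<open>Precontact relations between ultrafilters\<close>

definition lifted :: "('a \<Rightarrow> 'a \<Rightarrow> bool) \<Rightarrow> 'a set \<Rightarrow> 'a set \<Rightarrow> bool"
  where "lifted C F G \<longleftrightarrow> (\<forall>a\<in>F. \<forall>b\<in>G. C a b)"

context precontact_algebra
begin

lemma ble_refl: "a \<in> carrier A \<Longrightarrow> a \<^bold>\<le> a"
  by (simp add: ble_def)

text \<open>The axioms are invariant under exchanging the arguments, so results about the right
  argument also serve for the left one.\<close>

lemma precontact_converse: "precontact_algebra A (\<lambda>a b. C b a)"
proof
  fix a b assume "a \<in> carrier A" "b \<in> carrier A" "C b a"
  then show "a \<noteq> \<^bold>0 \<and> b \<noteq> \<^bold>0" using nonzero by blast
next
  fix a b a' b' assume "a \<in> carrier A" "b \<in> carrier A" "a' \<in> carrier A" "b' \<in> carrier A"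
    "C b a" "a \<^bold>\<le> a'" "b \<^bold>\<le> b'"
  then show "C b' a'" using upward[of b a b' a'] by simp
qed (erule (3) left_additive right_additive)+

text \<open>These are the elements that an ultrafilter \<open>W\<close> with
  \<open>lifted C F W\<close> has to avoid. Witnesses \<open>a\<close> and \<open>a'\<close> for two
  of them are replaced by their meet, which stays in \<open>F\<close> and works for both by
  monotonicity; additivity then handles the join.\<close>

lemma ideal_not_related:
  assumes F: "meet_base F"
  shows "ideal {b \<in> carrier A. \<exists>a\<in>F. \<not> C a b}" (is "ideal ?I")
  unfolding ideal_def
proof (intro conjI ballI)
  have cl: "\<And>a. a \<in> F \<Longrightarrow> a \<in> carrier A" using F by (auto simp: meet_base_def)
  show "?I \<subseteq> carrier A" by auto
  show "\<^bold>0 \<in> ?I" using F nonzero[of _ "\<^bold>0"] unfolding meet_base_def by blast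
  fix b c assume b: "b \<in> ?I"
  then obtain a where a: "a \<in> F" "\<not> C a b" "b \<in> carrier A" by blast
  {
    assume "c \<in> ?I"
    then obtain a' where a': "a' \<in> F" "\<not> C a' c" "c \<in> carrier A" by blast
    have "a \<^bold>\<cdot> a' \<in> F" using F a a' by (simp add: meet_base_def)
    moreover have "\<not> C (a \<^bold>\<cdot> a') b" "\<not> C (a \<^bold>\<cdot> a') c"
      using upward[of "a \<^bold>\<cdot> a'" b a b] upward[of "a \<^bold>\<cdot> a'" c a' c] meet_leI[of a a'] a a' cl ble_refl
      by blast+
    ultimately show "b \<^bold>+ c \<in> ?I"
      using right_additive[of "a \<^bold>\<cdot> a'" b c] a a' cl by blast
  next
    assume "c \<in> carrier A"
    then have "\<not> C a (b \<^bold>\<cdot> c)"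
      using upward[of a "b \<^bold>\<cdot> c" a b] meet_leI[of b c] a cl ble_refl by blast
    then show "b \<^bold>\<cdot> c \<in> ?I" using a \<open>c \<in> carrier A\<close> by blast
  }
qed

end

section \<open>The criterion for a common ultrafilter\<close>

context boolean_alg
begin

text \<open>With overlap as a precontact relation, inclusion in an ultrafilter becomes a case of
  \<open>lifted\<close>, and extension problems fall under the same criterion.\<close>

lemma precontact_overlap: "precontact_algebra A (\<lambda>a b. a \<^bold>\<cdot> b \<noteq> \<^bold>0)"
proof
  fix a b a' b' assume cl: "a \<in> carrier A" "b \<in> carrier A" "a' \<in> carrier A" "b' \<in> carrier A"
    and ne: "a \<^bold>\<cdot> b \<noteq> \<^bold>0" and le: "a \<^bold>\<le> a'" "b \<^bold>\<le> b'"
  have "(a \<^bold>\<cdot> b) \<^bold>\<cdot> (a' \<^bold>\<cdot> b') = (a \<^bold>\<cdot> a') \<^bold>\<cdot> (b \<^bold>\<cdot> b')" using cl by (simp add: meet_ac)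
  also have "\<dots> = a \<^bold>\<cdot> b" using le by (simp add: ble_def)
  finally show "a' \<^bold>\<cdot> b' \<noteq> \<^bold>0" using ne cl by auto
qed (auto simp: meet_join_distrib join_meet_distrib_right)

text \<open>Avoiding the ideal of \<open>F\<close> means \<open>lifted C F W\<close>, and likewise
  for \<open>G\<close>. An ultrafilter avoiding both ideals exists if their sum is proper; otherwise
  \<open>one_in_ideal_sum\<close> supplies a \<open>p\<close> that contradicts
  \<open>sep\<close>.\<close>

lemma common_ultrafilter:
  assumes C: "precontact_algebra A C" and D: "precontact_algebra A D"
    and F: "meet_base F" and G: "meet_base G"
    and sep: "\<And>a b p. \<lbrakk>a \<in> F; b \<in> G; p \<in> carrier A\<rbrakk> \<Longrightarrow> C a p \<or> D b (\<^bold>- p)"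
  shows "\<exists>W. ultrafilter W \<and> lifted C F W \<and> lifted D G W"
proof -
  interpret C: precontact_algebra A C by (rule C)
  interpret D: precontact_algebra A D by (rule D)
  let ?I = "{b \<in> carrier A. \<exists>a\<in>F. \<not> C a b}" and ?J = "{b \<in> carrier A. \<exists>a\<in>G. \<not> D a b}"
  have IJ: "ideal ?I" "ideal ?J" using C.ideal_not_related[OF F] D.ideal_not_related[OF G] by auto
  then have "\<^bold>1 \<notin> ideal_sum ?I ?J" using one_in_ideal_sum[OF IJ] sep by blast
  then obtain W where W: "ultrafilter W" "W \<inter> ideal_sum ?I ?J = {}"
    using ultrafilter_avoiding_ideal[OF ideal_ideal_sum[OF IJ]] by blast
  then have "lifted C F W" "lifted D G W"
    using subset_ideal_sum[OF IJ] ultrafilter_closed[OF W(1)] unfolding lifted_def by blast+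
  then show ?thesis using W(1) by blast
qed

text \<open>The middle ultrafilter contains the separating element or its complement, and each case
  contradicts one of the two lifted relations. All axioms of Efremovich type are exploited in this
  way.\<close>

lemma lifted_trans:
  assumes U: "ultrafilter U" and FG: "F \<subseteq> carrier A" "G \<subseteq> carrier A"
    and sep: "\<And>a b. \<lbrakk>a \<in> carrier A; b \<in> carrier A; \<not> E a b\<rbrakk>
      \<Longrightarrow> \<exists>c\<in>carrier A. \<not> C a c \<and> \<not> D (\<^bold>- c) b"
    and C: "lifted C F U" and D: "lifted D U G"
  shows "lifted E F G"
  unfolding lifted_def
proof (intro ballI)
  fix a b assume ab: "a \<in> F" "b \<in> G"
  show "E a b"
  proof (rule ccontr)
    assume "\<not> E a b"
    then obtain c where c: "c \<in> carrier A" "\<not> C a c" "\<not> D (\<^bold>- c) b"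
      using sep[of a b] ab FG by blast
    then have "c \<notin> U" "\<^bold>- c \<notin> U" using C D ab by (auto simp: lifted_def)
    then show False using U c(1) by simp
  qed
qed

text \<open>If \<open>a\<close> overlaps every member of \<open>U\<close>, then its complement is
  not a member, so \<open>a\<close> is one.\<close>

lemma lifted_overlap_iff_subset:
  assumes U: "ultrafilter U" and F: "F \<subseteq> carrier A"
  shows "lifted (\<lambda>a b. a \<^bold>\<cdot> b \<noteq> \<^bold>0) F U \<longleftrightarrow> F \<subseteq> U"
proof
  assume L: "lifted (\<lambda>a b. a \<^bold>\<cdot> b \<noteq> \<^bold>0) F U"
  show "F \<subseteq> U"
  proof
    fix a assume "a \<in> F"
    then have "\<^bold>- a \<notin> U" using L F meet_compl[of a] by (auto simp: lifted_def)
    then show "a \<in> U" using U F \<open>a \<in> F\<close> by auto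
  qed
next
  assume "F \<subseteq> U"
  then show "lifted (\<lambda>a b. a \<^bold>\<cdot> b \<noteq> \<^bold>0) F U"
    unfolding lifted_def using ultrafilter_simps(1,5)[OF U] ultrafilter_closed[OF U]
    by (metis subsetD)
qed

end

section \<open>Representation by ultrafilters\<close>

context precontact_algebra
begin

text \<open>The criterion with \<open>C\<close> on \<open>F\<close> and overlap on \<open>G\<close>.
  An element \<open>b\<close> of \<open>G\<close> disjoint from the complement of \<open>p\<close>
  lies below \<open>p\<close>, so \<open>C a b\<close> passes up to \<open>C a p\<close>.\<close>

lemma extend_right:
  assumes F: "meet_base F" and G: "meet_base G" and FG: "lifted C F G"
  shows "\<exists>V. ultrafilter V \<and> G \<subseteq> V \<and> lifted C F V"
proof -
  have cl: "F \<subseteq> carrier A" "G \<subseteq> carrier A" using F G by (auto simp: meet_base_def)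
  have "C a p \<or> b \<^bold>\<cdot> \<^bold>- p \<noteq> \<^bold>0" if "a \<in> F" "b \<in> G" "p \<in> carrier A" for a b p
  proof (intro disjCI)
    assume z: "\<not> b \<^bold>\<cdot> \<^bold>- p \<noteq> \<^bold>0"
    have ab: "a \<in> carrier A" "b \<in> carrier A" using that cl by auto
    have "b \<^bold>\<cdot> (p \<^bold>+ \<^bold>- p) = b \<^bold>\<cdot> p"
      using z ab that(3) by (simp only: meet_join_distrib join_zero meet_closed compl_closed simp_thms)
    then have "b \<^bold>\<le> p" using ab that(3) by (simp add: ble_def join_compl meet_one)
    then show "C a p"
      using FG that ab upward[of a b a p] ble_refl[of a] by (simp add: lifted_def)
  qed
  then obtain V where "ultrafilter V" "lifted C F V" "lifted (\<lambda>a b. a \<^bold>\<cdot> b \<noteq> \<^bold>0) G V"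
    using common_ultrafilter[OF precontact_algebra_axioms precontact_overlap F G] by blast
  then show ?thesis using lifted_overlap_iff_subset cl by blast
qed

text \<open>The singletons of \<open>a\<close> and \<open>b\<close> are enlarged to ultrafilters one
  after the other; on the left this is \<open>extend_right\<close> for the converse.\<close>

lemma related_iff_ultrafilters:
  assumes ab: "a \<in> carrier A" "b \<in> carrier A"
  shows "C a b \<longleftrightarrow> (\<exists>U V. ultrafilter U \<and> ultrafilter V \<and> lifted C U V \<and> a \<in> U \<and> b \<in> V)"
proof
  assume "C a b"
  interpret conv: precontact_algebra A "\<lambda>a b. C b a" by (rule precontact_converse)
  have "lifted (\<lambda>a b. C b a) {b} {a}" using \<open>C a b\<close> by (simp add: lifted_def)
  then obtain U where U: "ultrafilter U" "{a} \<subseteq> U" "lifted (\<lambda>a b. C b a) {b} U"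
    using conv.extend_right singleton_meet_base ab by blast
  then have "lifted C U {b}" by (simp add: lifted_def)
  then obtain V where "ultrafilter V" "{b} \<subseteq> V" "lifted C U V"
    using extend_right[OF ultrafilter_meet_base[OF U(1)] singleton_meet_base] ab by blast
  then show "\<exists>U V. ultrafilter U \<and> ultrafilter V \<and> lifted C U V \<and> a \<in> U \<and> b \<in> V"
    using U by blast
qed (auto simp: lifted_def)

end

context boolean_alg
begin

text \<open>A nonzero element overlaps itself, so representing the overlap relation yields the
  ultrafilter.\<close>

lemma ultrafilter_containing:
  assumes "a \<in> carrier A" "a \<noteq> \<^bold>0"
  shows "\<exists>U. ultrafilter U \<and> a \<in> U"
proof -
  interpret overlap: precontact_algebra A "\<lambda>a b. a \<^bold>\<cdot> b \<noteq> \<^bold>0" by (rule precontact_overlap)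
  show ?thesis using overlap.related_iff_ultrafilters[of a a] assms by auto
qed

lemma eq_iff_ultrafilters:
  assumes ab: "a \<in> carrier A" "b \<in> carrier A"
  shows "a = b \<longleftrightarrow> (\<forall>U. ultrafilter U \<longrightarrow> (a \<in> U \<longleftrightarrow> b \<in> U))"
proof
  assume same: "\<forall>U. ultrafilter U \<longrightarrow> (a \<in> U \<longleftrightarrow> b \<in> U)"
  \<comment> \<open>Otherwise the meet of \<open>x\<close> with the complement of \<open>y\<close>
    would be nonzero and lie in an ultrafilter containing \<open>x\<close> but not
    \<open>y\<close>.\<close>
  have le: "x \<^bold>\<cdot> y = x" if "x \<in> carrier A" "y \<in> carrier A" "\<And>U. ultrafilter U \<Longrightarrow> x \<in> U \<Longrightarrow> y \<in> U" for x y
  proof -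
    have "x \<^bold>\<cdot> \<^bold>- y = \<^bold>0"
      using ultrafilter_containing[of "x \<^bold>\<cdot> \<^bold>- y"] that
      by (metis compl_closed meet_closed ultrafilter_simps(3,5))
    then have "x \<^bold>\<cdot> (y \<^bold>+ \<^bold>- y) = x \<^bold>\<cdot> y"
      using that(1,2) by (simp only: meet_join_distrib join_zero meet_closed compl_closed)
    then show ?thesis using that(1,2) by (simp add: join_compl meet_one)
  qed
  show "a = b" using le[of a b] le[of b a] same ab meet_comm by metis
qed auto

end

section \<open>Quotients by sets of ultrafilters\<close>

text \<open>Identities pass to surjective homomorphic images; the quotient below obtains its axioms
  in this way.\<close>

lemma (in boolean_alg) boolean_alg_image:
  assumes hom: "boolean_hom h A D" and surj: "carrier D = h ` carrier A"
  shows "boolean_alg D"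
proof -
  have hom_simps:
    "\<^bold>0\<^bsub>D\<^esub> = h \<^bold>0" "\<^bold>1\<^bsub>D\<^esub> = h \<^bold>1"
    "\<And>a b. \<lbrakk>a \<in> carrier A; b \<in> carrier A\<rbrakk> \<Longrightarrow> h a \<^bold>+\<^bsub>D\<^esub> h b = h (a \<^bold>+ b)"
    "\<And>a b. \<lbrakk>a \<in> carrier A; b \<in> carrier A\<rbrakk> \<Longrightarrow> h a \<^bold>\<cdot>\<^bsub>D\<^esub> h b = h (a \<^bold>\<cdot> b)"
    "\<And>a. a \<in> carrier A \<Longrightarrow> \<^bold>-\<^bsub>D\<^esub> h a = h (\<^bold>- a)"
    using hom by (auto simp: boolean_hom_def)
  show ?thesis
  proof (unfold_locales, unfold surj, goal_cases)
    case (6 a b c) then show ?case by (auto simp: hom_simps join_assoc)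
  next
    case (7 a b c) then show ?case by (auto simp: hom_simps meet_assoc)
  next
    case (8 a b) then show ?case by (auto simp: hom_simps join_comm)
  next
    case (9 a b) then show ?case by (auto simp: hom_simps meet_comm)
  next
    case (10 a b c) then show ?case by (auto simp: hom_simps meet_join_distrib)
  next
    case (11 a b c) then show ?case by (auto simp: hom_simps join_meet_distrib)
  next
    case (12 a) then show ?case by (auto simp: hom_simps join_zero)
  next
    case (13 a) then show ?case by (auto simp: hom_simps meet_one)
  next
    case (14 a) then show ?case by (auto simp: hom_simps join_compl)
  next
    case (15 a) then show ?case by (auto simp: hom_simps meet_compl)
  qed (auto simp: hom_simps)
qed

context boolean_alg
begin

text \<open>For a set \<open>P\<close> of ultrafilters, \<open>trace P a\<close> is the set of all elements below \<open>a\<close> modulo the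
  ideal of those elements that belong to no member of \<open>P\<close>. It represents the class of \<open>a\<close> in the
  quotient by this ideal.\<close>

definition trace :: "'a set set \<Rightarrow> 'a \<Rightarrow> 'a set"
  where "trace P a = {x \<in> carrier A. \<forall>U\<in>P. x \<in> U \<longrightarrow> a \<in> U}"

text \<open>The operations are read off the sets without choosing representatives: for
  \<open>U\<close> in \<open>P\<close>, \<open>trace P a\<close> meets \<open>U\<close> exactly when
  \<open>a\<close> is in \<open>U\<close>. Since meets are intersections, the order is
  inclusion.\<close>

definition quotient_alg :: "'a set set \<Rightarrow> 'a set bool_alg"
  where "quotient_alg P =
    \<lparr> carrier = trace P ` carrier A,
      bzero = trace P \<^bold>0,
      bone = trace P \<^bold>1,
      bjoin = (\<lambda>X Y. {z \<in> carrier A. \<forall>U\<in>P. z \<in> U \<longrightarrow> U \<inter> X \<noteq> {} \<or> U \<inter> Y \<noteq> {}}),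
      bmeet = (\<inter>),
      bcompl = (\<lambda>X. {z \<in> carrier A. \<forall>U\<in>P. z \<in> U \<longrightarrow> U \<inter> X = {}}) \<rparr>"

definition quotient_contact ::
    "'a set set \<Rightarrow> ('a set \<Rightarrow> 'a set \<Rightarrow> bool) \<Rightarrow> 'a set \<Rightarrow> 'a set \<Rightarrow> bool"
  where "quotient_contact P R X Y \<longleftrightarrow>
    (\<exists>U\<in>P. \<exists>V\<in>P. R U V \<and> U \<inter> X \<noteq> {} \<and> V \<inter> Y \<noteq> {})"

lemma meets_trace_iff:
  assumes "U \<in> P" "a \<in> carrier A"
  shows "U \<inter> trace P a \<noteq> {} \<longleftrightarrow> a \<in> U"
  using assms by (auto simp: trace_def)

lemma trace_eq_zero_iff:
  assumes P: "\<forall>U\<in>P. ultrafilter U" and a: "a \<in> carrier A"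
  shows "trace P a = trace P \<^bold>0 \<longleftrightarrow> (\<forall>U\<in>P. a \<notin> U)"
proof
  assume "trace P a = trace P \<^bold>0"
  then show "\<forall>U\<in>P. a \<notin> U"
    using P meets_trace_iff[of _ P a] meets_trace_iff[of _ P "\<^bold>0"] a ultrafilter_simps(1) zero_closed
    by metis
next
  assume "\<forall>U\<in>P. a \<notin> U"
  then show "trace P a = trace P \<^bold>0" using P by (auto simp: trace_def)
qed

lemma boolean_hom_trace:
  assumes P: "\<forall>U\<in>P. ultrafilter U"
  shows "boolean_hom (trace P) A (quotient_alg P)"
proof -
  have "trace P (a \<^bold>+ b) = {z \<in> carrier A. \<forall>U\<in>P. z \<in> U \<longrightarrow> U \<inter> trace P a \<noteq> {} \<or> U \<inter> trace P b \<noteq> {}}"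
    if "a \<in> carrier A" "b \<in> carrier A" for a b
    using that P meets_trace_iff[of _ P] by (auto simp add: trace_def)
  moreover have "trace P (a \<^bold>\<cdot> b) = trace P a \<inter> trace P b"
    if "a \<in> carrier A" "b \<in> carrier A" for a b
    using that P by (auto simp: trace_def)
  moreover have "trace P (\<^bold>- a) = {z \<in> carrier A. \<forall>U\<in>P. z \<in> U \<longrightarrow> U \<inter> trace P a = {}}"
    if "a \<in> carrier A" for a
    using that P meets_trace_iff[of _ P a] by (auto simp add: trace_def)
  ultimately show ?thesis by (simp add: boolean_hom_def quotient_alg_def)
qed

lemma boolean_alg_quotient:
  assumes P: "\<forall>U\<in>P. ultrafilter U"
  shows "boolean_alg (quotient_alg P)"
  by (rule boolean_alg_image[OF boolean_hom_trace[OF P]]) (simp add: quotient_alg_def)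

lemma quotient_contact_trace:
  assumes "a \<in> carrier A" "b \<in> carrier A"
  shows "quotient_contact P R (trace P a) (trace P b) \<longleftrightarrow>
    (\<exists>U\<in>P. \<exists>V\<in>P. R U V \<and> a \<in> U \<and> b \<in> V)"
  using assms by (simp add: quotient_contact_def meets_trace_iff cong: conj_cong bex_cong)

text \<open>Additivity comes from primeness of ultrafilters, and the overlap axiom from reflexivity
  of \<open>R\<close> at a member of \<open>P\<close> that contains the meet.\<close>

lemma contact_algebra_quotient:
  assumes P: "\<forall>U\<in>P. ultrafilter U"
    and refl: "\<And>U. U \<in> P \<Longrightarrow> R U U"
    and sym: "\<And>U V. \<lbrakk>U \<in> P; V \<in> P; R U V\<rbrakk> \<Longrightarrow> R V U"
  shows "contact_algebra (quotient_alg P) (quotient_contact P R)" (is "contact_algebra ?Q ?C")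
proof -
  interpret Q: boolean_alg ?Q by (rule boolean_alg_quotient[OF P])
  have hom: "trace P a \<^bold>+\<^bsub>?Q\<^esub> trace P b = trace P (a \<^bold>+ b)"
    "trace P a \<^bold>\<cdot>\<^bsub>?Q\<^esub> trace P b = trace P (a \<^bold>\<cdot> b)"
    if "a \<in> carrier A" "b \<in> carrier A" for a b
    using boolean_hom_trace[OF P] that by (auto simp: boolean_hom_def)
  have car: "carrier ?Q = trace P ` carrier A" and zero: "\<^bold>0\<^bsub>?Q\<^esub> = trace P \<^bold>0"
    by (simp_all add: quotient_alg_def)
  show ?thesis
  proof (unfold_locales, unfold car zero, goal_cases)
    case (1 X Y)
    then obtain a b where "a \<in> carrier A" "b \<in> carrier A" "X = trace P a" "Y = trace P b" by blast
    then show ?case using 1(3) trace_eq_zero_iff[OF P] quotient_contact_trace[of a b P R] by auto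
  next
    case (2 X Y X' Y')
    then have "X \<subseteq> X'" "Y \<subseteq> Y'" by (auto simp: ble_def quotient_alg_def)
    then show ?case using 2(5) unfolding quotient_contact_def by blast
  next
    case (3 X Y Z)
    then obtain a b c where "a \<in> carrier A" "b \<in> carrier A" "c \<in> carrier A"
      "X = trace P a" "Y = trace P b" "Z = trace P c" by blast
    then show ?case using 3(4) P
      by (simp add: hom quotient_contact_trace del: bex_simps) (metis ultrafilter_simps(4))
  next
    case (4 X Y Z)
    then obtain a b c where "a \<in> carrier A" "b \<in> carrier A" "c \<in> carrier A"
      "X = trace P a" "Y = trace P b" "Z = trace P c" by blast
    then show ?case using 4(4) P
      by (simp add: hom quotient_contact_trace del: bex_simps) (metis ultrafilter_simps(4))
  next
    case (5 X Y)
    then show ?case using sym unfolding quotient_contact_def by blast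
  next
    case (6 X Y)
    then obtain a b where ab: "a \<in> carrier A" "b \<in> carrier A" "X = trace P a" "Y = trace P b"
      by blast
    then obtain U where "U \<in> P" "a \<^bold>\<cdot> b \<in> U"
      using 6(3) hom trace_eq_zero_iff[OF P, of "a \<^bold>\<cdot> b"] by auto
    then have "U \<in> P" "a \<in> U" "b \<in> U" using P ab by auto
    then show ?case using refl ab quotient_contact_trace[of a b P R] by blast
  qed
qed

end

section \<open>Full standard dynamic contact algebras\<close>

lemma full_standard_simps [simp]:
  "carrier (full_standard_dca T before Bs Cs) = (\<Pi>\<^sub>E i\<in>T. carrier (Bs i))"
  "\<^bold>0\<^bsub>full_standard_dca T before Bs Cs\<^esub> = (\<lambda>i\<in>T. \<^bold>0\<^bsub>Bs i\<^esub>)"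
  "\<^bold>1\<^bsub>full_standard_dca T before Bs Cs\<^esub> = (\<lambda>i\<in>T. \<^bold>1\<^bsub>Bs i\<^esub>)"
  "a \<^bold>+\<^bsub>full_standard_dca T before Bs Cs\<^esub> b = (\<lambda>i\<in>T. a i \<^bold>+\<^bsub>Bs i\<^esub> b i)"
  "a \<^bold>\<cdot>\<^bsub>full_standard_dca T before Bs Cs\<^esub> b = (\<lambda>i\<in>T. a i \<^bold>\<cdot>\<^bsub>Bs i\<^esub> b i)"
  "\<^bold>-\<^bsub>full_standard_dca T before Bs Cs\<^esub> a = (\<lambda>i\<in>T. \<^bold>-\<^bsub>Bs i\<^esub> a i)"
  "C\<^sup>s\<^bsub>full_standard_dca T before Bs Cs\<^esub> a b \<longleftrightarrow> (\<exists>m\<in>T. Cs m (a m) (b m))"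
  by (simp_all add: full_standard_dca_def)

text \<open>First-order counterparts of the axioms on a time structure. \<open>Tri\<close> involves
  equality because time contact in a standard algebra means sharing an instant.\<close>

primrec time_condition :: "time_axiom \<Rightarrow> 'i set \<Rightarrow> ('i \<Rightarrow> 'i \<Rightarrow> bool) \<Rightarrow> bool" where
  "time_condition RS T R \<longleftrightarrow> (\<forall>i\<in>T. \<exists>j\<in>T. R i j)"
| "time_condition LS T R \<longleftrightarrow> (\<forall>i\<in>T. \<exists>j\<in>T. R j i)"
| "time_condition UpDir T R \<longleftrightarrow> (\<forall>i\<in>T. \<forall>j\<in>T. \<exists>k\<in>T. R i k \<and> R j k)"
| "time_condition DownDir T R \<longleftrightarrow> (\<forall>i\<in>T. \<forall>j\<in>T. \<exists>k\<in>T. R k i \<and> R k j)"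
| "time_condition Circ T R \<longleftrightarrow> (\<forall>i\<in>T. \<forall>j\<in>T. R i j \<longrightarrow> (\<exists>k\<in>T. R j k \<and> R k i))"
| "time_condition Dens T R \<longleftrightarrow> (\<forall>i\<in>T. \<forall>j\<in>T. R i j \<longrightarrow> (\<exists>k\<in>T. R i k \<and> R k j))"
| "time_condition Ref T R \<longleftrightarrow> (\<forall>i\<in>T. R i i)"
| "time_condition Lin T R \<longleftrightarrow> (\<forall>i\<in>T. \<forall>j\<in>T. R i j \<or> R j i)"
| "time_condition Tri T R \<longleftrightarrow> (\<forall>i\<in>T. \<forall>j\<in>T. i = j \<or> R i j \<or> R j i)"
| "time_condition Tr T R \<longleftrightarrow> (\<forall>i\<in>T. \<forall>j\<in>T. \<forall>k\<in>T. R i j \<longrightarrow> R j k \<longrightarrow> R i k)"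

text \<open>Nondegenerate factors make the unit nonzero at every instant and allow elements with any
  prescribed support. The existence of an instant then separates zero from one in the
  product.\<close>

locale full_standard =
  fixes T :: "'i set" and before :: "'i \<Rightarrow> 'i \<Rightarrow> bool"
    and Bs :: "'i \<Rightarrow> 'b bool_alg" and Cs :: "'i \<Rightarrow> 'b \<Rightarrow> 'b \<Rightarrow> bool"
  assumes factor: "i \<in> T \<Longrightarrow> contact_algebra (Bs i) (Cs i)"
    and factor_nondegenerate: "i \<in> T \<Longrightarrow> \<^bold>0\<^bsub>Bs i\<^esub> \<noteq> \<^bold>1\<^bsub>Bs i\<^esub>"
    and nonempty: "T \<noteq> {}"
begin

abbreviation D :: "('i \<Rightarrow> 'b) dca"
  where "D \<equiv> full_standard_dca T before Bs Cs"

text \<open>The instants at which \<open>a\<close> exists. Time contact and precedence depend on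
  supports only, so their axioms reduce to statements about sets of instants.\<close>

definition supp :: "('i \<Rightarrow> 'b) \<Rightarrow> 'i set"
  where "supp a = {i \<in> T. a i \<noteq> \<^bold>0\<^bsub>Bs i\<^esub>}"

lemma factor_boolean: "i \<in> T \<Longrightarrow> boolean_alg (Bs i)"
  using factor contact_algebra.axioms(1) precontact_algebra.axioms(1) by blast

lemma component_closed:
  "\<lbrakk>a \<in> (\<Pi>\<^sub>E i\<in>T. carrier (Bs i)); i \<in> T\<rbrakk> \<Longrightarrow> a i \<in> carrier (Bs i)"
  by (rule PiE_mem)

lemma boolean_alg_D: "boolean_alg D"
proof (unfold_locales, unfold full_standard_simps, goal_cases)
  case (6 a b c) then show ?case
    by (auto simp: boolean_alg.join_assoc[OF factor_boolean] component_closed intro!: restrict_ext)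
next
  case (7 a b c) then show ?case
    by (auto simp: boolean_alg.meet_assoc[OF factor_boolean] component_closed intro!: restrict_ext)
next
  case (8 a b) then show ?case
    by (intro restrict_ext boolean_alg.join_comm[OF factor_boolean]) auto
next
  case (9 a b) then show ?case
    by (intro restrict_ext boolean_alg.meet_comm[OF factor_boolean]) auto
next
  case (10 a b c) then show ?case
    by (auto simp: boolean_alg.meet_join_distrib[OF factor_boolean] component_closed intro!: restrict_ext)
next
  case (11 a b c) then show ?case
    by (auto simp: boolean_alg.join_meet_distrib[OF factor_boolean] component_closed intro!: restrict_ext)
next
  case (12 a) then show ?case
    by (intro extensionalityI[of _ T]) (auto simp: boolean_alg.join_zero[OF factor_boolean] component_closed PiE_iff)
next
  case (13 a) then show ?case
    by (intro extensionalityI[of _ T]) (auto simp: boolean_alg.meet_one[OF factor_boolean] component_closed PiE_iff)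
next
  case (14 a) then show ?case
    by (auto simp: boolean_alg.join_compl[OF factor_boolean] component_closed intro!: restrict_ext)
next
  case (15 a) then show ?case
    by (auto simp: boolean_alg.meet_compl[OF factor_boolean] component_closed intro!: restrict_ext)
qed (auto simp: component_closed intro!: boolean_alg.closed[OF factor_boolean])

sublocale boolean_alg D
  by (rule boolean_alg_D)

lemma time_iff: "C\<^sup>t\<^bsub>D\<^esub> a b \<longleftrightarrow> supp a \<inter> supp b \<noteq> {}"
  by (auto simp: full_standard_dca_def supp_def)

lemma prec_iff: "\<B>\<^bsub>D\<^esub> a b \<longleftrightarrow> (\<exists>m\<in>supp a. \<exists>n\<in>supp b. before m n)"
  by (auto simp: full_standard_dca_def supp_def)

lemma supp_zero: "supp \<^bold>0\<^bsub>D\<^esub> = {}"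
  by (auto simp: supp_def)

lemma supp_one: "supp \<^bold>1\<^bsub>D\<^esub> = T"
  using factor_nondegenerate[symmetric] by (auto simp: supp_def)

lemma nonzero_iff_supp: "a \<in> carrier D \<Longrightarrow> a \<noteq> \<^bold>0\<^bsub>D\<^esub> \<longleftrightarrow> supp a \<noteq> {}"
proof -
  assume a: "a \<in> carrier D"
  have "a = \<^bold>0\<^bsub>D\<^esub>" if "supp a = {}"
    using a that by (intro extensionalityI[of _ T]) (auto simp: supp_def PiE_iff)
  then show ?thesis using supp_zero by auto
qed

lemma supp_join:
  assumes "a \<in> carrier D" "b \<in> carrier D"
  shows "supp (a \<^bold>+\<^bsub>D\<^esub> b) \<subseteq> supp a \<union> supp b"
  using boolean_alg.join_zero[OF factor_boolean boolean_alg.zero_closed[OF factor_boolean]]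
  by (auto simp: supp_def)

lemma supp_meet:
  assumes "a \<in> carrier D" "b \<in> carrier D"
  shows "supp (a \<^bold>\<cdot>\<^bsub>D\<^esub> b) \<subseteq> supp a \<inter> supp b"
  using assms boolean_alg.meet_zero[OF factor_boolean] boolean_alg.zero_meet[OF factor_boolean]
  by (auto simp: supp_def component_closed)

lemma supp_mono: "\<lbrakk>a \<in> carrier D; b \<in> carrier D; a \<^bold>\<le>\<^bsub>D\<^esub> b\<rbrakk> \<Longrightarrow> supp a \<subseteq> supp b"
  using supp_meet[of a b] by (auto simp: ble_def)

lemma supp_compl: "a \<in> carrier D \<Longrightarrow> T \<subseteq> supp a \<union> supp (\<^bold>-\<^bsub>D\<^esub> a)"
  using supp_join[of a "\<^bold>-\<^bsub>D\<^esub> a"] supp_one join_compl[of a] compl_closed[of a] by metis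

text \<open>The indicator of \<open>S\<close> works, with values zero and one only. It supplies the
  separating elements that existential axioms ask for.\<close>

lemma ex_supp:
  assumes "S \<subseteq> T"
  shows "\<exists>c\<in>carrier D. supp c = S \<and> supp (\<^bold>-\<^bsub>D\<^esub> c) = T - S"
proof
  let ?c = "\<lambda>i\<in>T. if i \<in> S then \<^bold>1\<^bsub>Bs i\<^esub> else \<^bold>0\<^bsub>Bs i\<^esub>"
  show c: "?c \<in> carrier D"
    using boolean_alg.closed[OF factor_boolean] by auto
  have "supp ?c = S" using assms factor_nondegenerate[symmetric] by (auto simp: supp_def)
  moreover have "i \<notin> supp (\<^bold>-\<^bsub>D\<^esub> ?c)" if "i \<in> S" for i
  proof -
    have i: "i \<in> T" using that assms by auto
    show ?thesis using that i boolean_alg.compl_one[OF factor_boolean[OF i]] by (simp add: supp_def)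
  qed
  ultimately show "supp ?c = S \<and> supp (\<^bold>-\<^bsub>D\<^esub> ?c) = T - S"
    using supp_compl[OF c] by (auto simp: supp_def)
qed

section \<open>The product as a dynamic contact algebra\<close>

lemma time_contact_algebra: "contact_algebra D (C\<^sup>t\<^bsub>D\<^esub>)"
proof (unfold_locales, unfold time_iff, goal_cases)
  case (1 a b) then show ?case using supp_zero by blast
next
  case (2 a b a' b') then show ?case using supp_mono by blast
next
  case (3 a b c) then show ?case using supp_join[of b c] by blast
next
  case (4 a b c) then show ?case using supp_join[of a b] by blast
next
  case (5 a b) then show ?case by blast
next
  case (6 a b) then show ?case
    using supp_meet[of a b] nonzero_iff_supp[of "a \<^bold>\<cdot>\<^bsub>D\<^esub> b"] meet_closed[of a b] by blast
qed

lemma prec_precontact_algebra: "precontact_algebra D (\<B>\<^bsub>D\<^esub>)"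
proof (unfold_locales, unfold prec_iff, goal_cases)
  case (1 a b) then show ?case using supp_zero by blast
next
  case (2 a b a' b') then show ?case using supp_mono by blast
next
  case (3 a b c) then show ?case using supp_join[of b c] by blast
next
  case (4 a b c) then show ?case using supp_join[of a b] by blast
qed

lemma space_contact_algebra: "contact_algebra D (C\<^sup>s\<^bsub>D\<^esub>)"
proof -
  note pre = contact_algebra.axioms(1)[OF factor]
  show ?thesis
  proof (unfold_locales, goal_cases)
    case (1 a b)
    then obtain m where "m \<in> T" "Cs m (a m) (b m)" by auto
    then show ?case using precontact_algebra.nonzero[OF pre, of m "a m" "b m"] 1(1,2)
      by (auto simp: component_closed)
  next
    case (2 a b a' b')
    then obtain m where m: "m \<in> T" "Cs m (a m) (b m)" by auto
    have "a m \<^bold>\<cdot>\<^bsub>Bs m\<^esub> a' m = a m" "b m \<^bold>\<cdot>\<^bsub>Bs m\<^esub> b' m = b m"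
      using 2(6,7) m(1) by (auto simp: ble_def dest: fun_cong[of _ _ m])
    then have "Cs m (a' m) (b' m)"
      using precontact_algebra.upward[OF pre, of m "a m" "b m" "a' m" "b' m"] m 2(1-4)
      by (auto simp: ble_def component_closed)
    then show ?case using m(1) by auto
  next
    case (3 a b c)
    then obtain m where "m \<in> T" "Cs m (a m) (b m \<^bold>+\<^bsub>Bs m\<^esub> c m)" by auto
    then show ?case using precontact_algebra.right_additive[OF pre, of m "a m" "b m" "c m"] 3(1-3)
      by (auto simp: component_closed)
  next
    case (4 a b c)
    then obtain m where "m \<in> T" "Cs m (a m \<^bold>+\<^bsub>Bs m\<^esub> b m) (c m)" by auto
    then show ?case using precontact_algebra.left_additive[OF pre, of m "a m" "b m" "c m"] 4(1-3)
      by (auto simp: component_closed)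
  next
    case (5 a b)
    then obtain m where "m \<in> T" "Cs m (a m) (b m)" by auto
    then show ?case using contact_algebra.symmetric[OF factor, of m "a m" "b m"] 5(1,2)
      by (auto simp: component_closed)
  next
    case (6 a b)
    then obtain m where "m \<in> T" "a m \<^bold>\<cdot>\<^bsub>Bs m\<^esub> b m \<noteq> \<^bold>0\<^bsub>Bs m\<^esub>"
      by (auto simp: restrict_def fun_eq_iff split: if_splits)
    then show ?case using contact_algebra.overlap[OF factor, of m "a m" "b m"] 6(1,2)
      by (auto simp: component_closed)
  qed
qed

lemma space_imp_time:
  assumes "a \<in> carrier D" "b \<in> carrier D" "C\<^sup>s\<^bsub>D\<^esub> a b"
  shows "C\<^sup>t\<^bsub>D\<^esub> a b"
proof -
  obtain m where "m \<in> T" "Cs m (a m) (b m)" using assms(3) by auto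
  then have "m \<in> supp a \<inter> supp b"
    using precontact_algebra.nonzero[OF contact_algebra.axioms(1)[OF factor], of m "a m" "b m"] assms(1,2)
    by (auto simp: component_closed supp_def)
  then show ?thesis using time_iff by blast
qed

lemma supp_subset: "supp a \<subseteq> T"
  by (auto simp: supp_def)

text \<open>It suffices to prescribe the support of the separating element: the instants outside
  \<open>supp a\<close> in the first two existential axioms, and \<open>supp b\<close> in the
  third.\<close>

lemma dynamic_contact_algebra_D: "dynamic_contact_algebra D"
proof (intro dynamic_contact_algebra.intro dynamic_contact_algebra_axioms.intro
    boolean_alg_D space_contact_algebra time_contact_algebra prec_precontact_algebra)
  show "\<^bold>0\<^bsub>D\<^esub> \<noteq> \<^bold>1\<^bsub>D\<^esub>" using supp_zero supp_one nonempty by metis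
  show "\<And>a b. \<lbrakk>a \<in> carrier D; b \<in> carrier D; C\<^sup>s\<^bsub>D\<^esub> a b\<rbrakk> \<Longrightarrow> C\<^sup>t\<^bsub>D\<^esub> a b" by (rule space_imp_time)
next
  fix a b assume "\<not> C\<^sup>t\<^bsub>D\<^esub> a b"
  moreover obtain c where "c \<in> carrier D" "supp c = T - supp a" "supp (\<^bold>-\<^bsub>D\<^esub> c) = T - (T - supp a)"
    using ex_supp[of "T - supp a"] by blast
  ultimately show "\<exists>c\<in>carrier D. \<not> C\<^sup>t\<^bsub>D\<^esub> a c \<and> \<not> C\<^sup>t\<^bsub>D\<^esub> (\<^bold>-\<^bsub>D\<^esub> c) b"
    unfolding time_iff by (intro bexI[of _ c]) auto
next
  fix a b assume "\<not> \<B>\<^bsub>D\<^esub> a b"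
  moreover obtain c where "c \<in> carrier D" "supp c = T - supp a" "supp (\<^bold>-\<^bsub>D\<^esub> c) = T - (T - supp a)"
    using ex_supp[of "T - supp a"] by blast
  ultimately show "\<exists>c\<in>carrier D. \<not> C\<^sup>t\<^bsub>D\<^esub> a c \<and> \<not> \<B>\<^bsub>D\<^esub> (\<^bold>-\<^bsub>D\<^esub> c) b"
    unfolding time_iff prec_iff by (intro bexI[of _ c]) auto
next
  fix a b assume "\<not> \<B>\<^bsub>D\<^esub> a b"
  moreover obtain c where "c \<in> carrier D" "supp c = supp b" "supp (\<^bold>-\<^bsub>D\<^esub> c) = T - supp b"
    using ex_supp[OF supp_subset, of b] by blast
  ultimately show "\<exists>c\<in>carrier D. \<not> \<B>\<^bsub>D\<^esub> a c \<and> \<not> C\<^sup>t\<^bsub>D\<^esub> (\<^bold>-\<^bsub>D\<^esub> c) b"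
    unfolding time_iff prec_iff by (intro bexI[of _ c]) auto
qed

text \<open>Where the axiom mentions \<open>p\<close>, the instant \<open>k\<close> given by the
  condition lies in the support of \<open>p\<close> or of its complement, which decides the
  disjunction.\<close>

lemma time_condition_imp_holds_in:
  assumes "time_condition \<alpha> T before"
  shows "holds_in \<alpha> D"
proof -
  have compl: "k \<in> supp p \<or> k \<in> supp (\<^bold>-\<^bsub>D\<^esub> p)" if "p \<in> carrier D" "k \<in> T" for p k
    using supp_compl that by blast
  have nz: "\<exists>i\<in>T. i \<in> supp a" if "a \<in> carrier D" "a \<noteq> \<^bold>0\<^bsub>D\<^esub>" for a
    using nonzero_iff_supp supp_subset that by blast
  have sub: "i \<in> T" if "i \<in> supp a" for i a using supp_subset that by blast
  show ?thesis
  proof (cases \<alpha>)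
    case RS
    have "\<B>\<^bsub>D\<^esub> a \<^bold>1\<^bsub>D\<^esub>" if "a \<in> carrier D" "a \<noteq> \<^bold>0\<^bsub>D\<^esub>" for a
    proof -
      have "\<exists>i\<in>T. i \<in> supp a" using nz that by blast
      then obtain i where "i \<in> supp a" by blast
      moreover then obtain j where "j \<in> T" "before i j"
        using assms[unfolded RS time_condition.simps] sub by blast
      ultimately show ?thesis unfolding prec_iff supp_one by blast
    qed
    then show ?thesis using RS by simp
  next
    case LS
    have "\<B>\<^bsub>D\<^esub> \<^bold>1\<^bsub>D\<^esub> a" if "a \<in> carrier D" "a \<noteq> \<^bold>0\<^bsub>D\<^esub>" for a
    proof -
      have "\<exists>i\<in>T. i \<in> supp a" using nz that by blast
      then obtain i where "i \<in> supp a" by blast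
      moreover then obtain j where "j \<in> T" "before j i"
        using assms[unfolded LS time_condition.simps] sub by blast
      ultimately show ?thesis unfolding prec_iff supp_one by blast
    qed
    then show ?thesis using LS by simp
  next
    case UpDir
    show ?thesis unfolding UpDir holds_in.simps prec_iff
    proof (intro ballI impI)
      fix a b p assume p: "a \<in> carrier D" "b \<in> carrier D" "p \<in> carrier D" "a \<noteq> \<^bold>0\<^bsub>D\<^esub> \<and> b \<noteq> \<^bold>0\<^bsub>D\<^esub>"
      then obtain i j where "i \<in> supp a" "j \<in> supp b" using nz by blast
      moreover then obtain k where "k \<in> T" "before i k" "before j k"
        using assms[unfolded UpDir time_condition.simps] sub by blast
      ultimately show "(\<exists>m\<in>supp a. \<exists>n\<in>supp p. before m n) \<or> (\<exists>m\<in>supp b. \<exists>n\<in>supp (\<^bold>-\<^bsub>D\<^esub> p). before m n)"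
        using compl[OF p(3)] by blast
    qed
  next
    case DownDir
    show ?thesis unfolding DownDir holds_in.simps prec_iff
    proof (intro ballI impI)
      fix a b p assume p: "a \<in> carrier D" "b \<in> carrier D" "p \<in> carrier D" "a \<noteq> \<^bold>0\<^bsub>D\<^esub> \<and> b \<noteq> \<^bold>0\<^bsub>D\<^esub>"
      then obtain i j where "i \<in> supp a" "j \<in> supp b" using nz by blast
      moreover then obtain k where "k \<in> T" "before k i" "before k j"
        using assms[unfolded DownDir time_condition.simps] sub by blast
      ultimately show "(\<exists>m\<in>supp p. \<exists>n\<in>supp a. before m n) \<or> (\<exists>m\<in>supp (\<^bold>-\<^bsub>D\<^esub> p). \<exists>n\<in>supp b. before m n)"
        using compl[OF p(3)] by blast
    qed
  next
    case Circ
    show ?thesis unfolding Circ holds_in.simps prec_iff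
    proof (intro ballI impI)
      fix a b p assume p: "p \<in> carrier D" and "\<exists>m\<in>supp a. \<exists>n\<in>supp b. before m n"
      then obtain i j where "i \<in> supp a" "j \<in> supp b" "before i j" by blast
      moreover then obtain k where "k \<in> T" "before j k" "before k i"
        using assms[unfolded Circ time_condition.simps] sub by blast
      ultimately show "(\<exists>m\<in>supp b. \<exists>n\<in>supp p. before m n) \<or> (\<exists>m\<in>supp (\<^bold>-\<^bsub>D\<^esub> p). \<exists>n\<in>supp a. before m n)"
        using compl[OF p] by blast
    qed
  next
    case Dens
    show ?thesis unfolding Dens holds_in.simps prec_iff
    proof (intro ballI impI)
      fix a b p assume p: "p \<in> carrier D" and "\<exists>m\<in>supp a. \<exists>n\<in>supp b. before m n"
      then obtain i j where "i \<in> supp a" "j \<in> supp b" "before i j" by blast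
      moreover then obtain k where "k \<in> T" "before i k" "before k j"
        using assms[unfolded Dens time_condition.simps] sub by blast
      ultimately show "(\<exists>m\<in>supp a. \<exists>n\<in>supp p. before m n) \<or> (\<exists>m\<in>supp (\<^bold>-\<^bsub>D\<^esub> p). \<exists>n\<in>supp b. before m n)"
        using compl[OF p] by blast
    qed
  next
    case Ref
    then show ?thesis
      using assms sub unfolding Ref holds_in.simps time_condition.simps prec_iff time_iff by blast
  next
    case Lin
    show ?thesis unfolding Lin holds_in.simps prec_iff
    proof (intro ballI impI)
      fix a b assume "a \<in> carrier D" "b \<in> carrier D" "a \<noteq> \<^bold>0\<^bsub>D\<^esub> \<and> b \<noteq> \<^bold>0\<^bsub>D\<^esub>"
      then obtain i j where "i \<in> supp a" "j \<in> supp b" using nz by blast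
      then show "(\<exists>m\<in>supp a. \<exists>n\<in>supp b. before m n) \<or> (\<exists>m\<in>supp b. \<exists>n\<in>supp a. before m n)"
        using assms[unfolded Lin time_condition.simps] sub by blast
    qed
  next
    case Tri
    show ?thesis unfolding Tri holds_in.simps prec_iff time_iff
    proof (intro ballI impI)
      fix a b assume "a \<in> carrier D" "b \<in> carrier D" "a \<noteq> \<^bold>0\<^bsub>D\<^esub> \<and> b \<noteq> \<^bold>0\<^bsub>D\<^esub>"
      then obtain i j where "i \<in> supp a" "j \<in> supp b" using nz by blast
      moreover then have "i = j \<or> before i j \<or> before j i"
        using assms[unfolded Tri time_condition.simps] sub by blast
      ultimately show "supp a \<inter> supp b \<noteq> {} \<or> (\<exists>m\<in>supp a. \<exists>n\<in>supp b. before m n) \<or>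
          (\<exists>m\<in>supp b. \<exists>n\<in>supp a. before m n)"
        by blast
    qed
  next
    case Tr
    have trans: "before i k" if "before i j" "before j k" "i \<in> T" "j \<in> T" "k \<in> T" for i j k
      using assms[unfolded Tr time_condition.simps] that by blast
    show ?thesis unfolding Tr holds_in.simps prec_iff
    proof (intro ballI impI)
      fix a b assume ab: "\<not> (\<exists>m\<in>supp a. \<exists>n\<in>supp b. before m n)"
      \<comment> \<open>By transitivity, an instant of \<open>supp a\<close> that preceded one of
        these would precede an instant of \<open>supp b\<close>.\<close>
      let ?S = "{k \<in> T. \<exists>n\<in>supp b. before k n}"
      obtain c where c: "c \<in> carrier D" "supp c = ?S" "supp (\<^bold>-\<^bsub>D\<^esub> c) = T - ?S"
        using ex_supp[of ?S] by blast
      have "\<not> (\<exists>m\<in>supp a. \<exists>n\<in>supp c. before m n)"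
        using ab trans sub unfolding c(2) by blast
      moreover have "\<not> (\<exists>m\<in>supp (\<^bold>-\<^bsub>D\<^esub> c). \<exists>n\<in>supp b. before m n)" unfolding c(3) by blast
      ultimately show "\<exists>c\<in>carrier D. \<not> (\<exists>m\<in>supp a. \<exists>n\<in>supp c. before m n) \<and>
          \<not> (\<exists>m\<in>supp (\<^bold>-\<^bsub>D\<^esub> c). \<exists>n\<in>supp b. before m n)"
        using c(1) by blast
    qed
  qed
qed

text \<open>Single instants are supports in the full product, so a failure of transitivity gives
  elements \<open>a\<close> and \<open>b\<close> to separate. The middle instant lies in the support
  of the separating element or of its complement, which is contradictory either way.\<close>

lemma transitive_if_holds_in:
  assumes "holds_in Tr D"
  shows "time_condition Tr T before"
  unfolding time_condition.simps
proof (intro ballI impI)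
  fix i j k assume T: "i \<in> T" "j \<in> T" "k \<in> T" and R: "before i j" "before j k"
  obtain a b where ab: "a \<in> carrier D" "supp a = {i}" "b \<in> carrier D" "supp b = {k}"
    using ex_supp[of "{i}"] ex_supp[of "{k}"] T by blast
  show "before i k"
  proof (rule ccontr)
    assume "\<not> before i k"
    then have "\<not> \<B>\<^bsub>D\<^esub> a b" using ab by (simp add: prec_iff)
    then obtain c where c: "c \<in> carrier D" "\<not> \<B>\<^bsub>D\<^esub> a c" "\<not> \<B>\<^bsub>D\<^esub> (\<^bold>-\<^bsub>D\<^esub> c) b"
      using assms ab unfolding holds_in.simps by blast
    then show False using supp_compl[OF c(1)] ab R T(2) unfolding prec_iff by blast
  qed
qed

end

section \<open>The algebra of snapshots\<close>

text \<open>Every axiom except \<open>Tr\<close> is universal, and the embedding preserves and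
  reflects what it speaks about. \<open>Tr\<close> asks for a separating element, which might lie
  outside the image of \<open>h\<close>.\<close>

lemma holds_in_reflected:
  assumes A: "dynamic_contact_algebra A" and emb: "dca_embedding h A D"
    and D: "holds_in \<alpha> D" and ne: "\<alpha> \<noteq> Tr"
  shows "holds_in \<alpha> A"
proof -
  interpret dynamic_contact_algebra A by (rule A)
  have cl: "h a \<in> carrier D" if "a \<in> carrier A" for a
    using emb that by (auto simp: dca_embedding_def boolean_hom_def)
  have hom: "h \<^bold>0\<^bsub>A\<^esub> = \<^bold>0\<^bsub>D\<^esub>" "h \<^bold>1\<^bsub>A\<^esub> = \<^bold>1\<^bsub>D\<^esub>" "\<And>a. a \<in> carrier A \<Longrightarrow> h (\<^bold>-\<^bsub>A\<^esub> a) = \<^bold>-\<^bsub>D\<^esub> h a"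
    using emb by (auto simp: dca_embedding_def boolean_hom_def)
  have nz: "h a \<noteq> \<^bold>0\<^bsub>D\<^esub>" if "a \<in> carrier A" "a \<noteq> \<^bold>0\<^bsub>A\<^esub>" for a
    using emb that hom(1) zero_closed unfolding dca_embedding_def inj_on_def by metis
  have rel: "C\<^sup>t\<^bsub>A\<^esub> a b \<longleftrightarrow> C\<^sup>t\<^bsub>D\<^esub> (h a) (h b)" "\<B>\<^bsub>A\<^esub> a b \<longleftrightarrow> \<B>\<^bsub>D\<^esub> (h a) (h b)"
    if "a \<in> carrier A" "b \<in> carrier A" for a b
    using emb that by (auto simp: dca_embedding_def)
  show ?thesis
    using D ne by (cases \<alpha>) (simp_all add: rel hom cl nz)
qed

context contact_algebra
begin

lemma lifted_refl: "ultrafilter U \<Longrightarrow> lifted C U U"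
  unfolding lifted_def using overlap ultrafilter_closed ultrafilter_simps(1,5) by metis

lemma lifted_sym: "\<lbrakk>F \<subseteq> carrier A; G \<subseteq> carrier A; lifted C F G\<rbrakk> \<Longrightarrow> lifted C G F"
  unfolding lifted_def using symmetric by blast

end

section \<open>Clusters and their precedence\<close>

context dynamic_contact_algebra
begin

text \<open>The union of all ultrafilters \<open>V\<close> with \<open>lifted C\<^sup>t V U\<close>.\<close>

definition cluster :: "'a set \<Rightarrow> 'a set"
  where "cluster U = {a \<in> carrier A. \<forall>u\<in>U. C\<^sup>t a u}"

definition clusters :: "'a set set"
  where "clusters = cluster ` Collect ultrafilter"

text \<open>Recovers from a cluster the class of ultrafilters of which it is the union.\<close>

definition points :: "'a set \<Rightarrow> 'a set set"
  where "points \<Gamma> = {U. ultrafilter U \<and> U \<subseteq> \<Gamma>}"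

abbreviation precedes :: "'a set \<Rightarrow> 'a set \<Rightarrow> bool"
  where "precedes \<equiv> lifted \<B>"

lemma points_ultrafilter: "\<forall>U\<in>points \<Gamma>. ultrafilter U"
  by (simp add: points_def)

lemma lifted_cluster: "lifted C\<^sup>t (cluster U) U"
  by (auto simp: lifted_def cluster_def)

lemma cluster_closed: "cluster U \<subseteq> carrier A"
  by (auto simp: cluster_def)

lemma points_cluster_iff:
  assumes "ultrafilter U"
  shows "V \<in> points (cluster U) \<longleftrightarrow> ultrafilter V \<and> lifted C\<^sup>t V U"
  using ultrafilter_closed by (auto simp: points_def cluster_def lifted_def)

lemma self_in_points: "ultrafilter U \<Longrightarrow> U \<in> points (cluster U)"
  using points_cluster_iff time.lifted_refl by blast

lemma subset_cluster: "ultrafilter U \<Longrightarrow> U \<subseteq> cluster U"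
  using self_in_points by (auto simp: points_def)

text \<open>By the Efremovich axiom for \<open>C\<^sup>t\<close>, whatever is in contact with all of
  \<open>X\<close> is in contact with all of \<open>Y\<close>. Symmetry gives the other
  inclusion.\<close>

lemma cluster_eq:
  assumes U: "ultrafilter U" and V: "ultrafilter V" and UV: "lifted C\<^sup>t U V"
  shows "cluster U = cluster V"
proof -
  have "cluster X \<subseteq> cluster Y" if "ultrafilter X" "ultrafilter Y" "lifted C\<^sup>t X Y" for X Y
  proof -
    have cl: "Y \<subseteq> carrier A" using that(2) ultrafilter_closed by blast
    have "lifted C\<^sup>t (cluster X) Y"
      by (rule lifted_trans[OF that(1) cluster_closed cl time_efremovich lifted_cluster that(3)])
    then show ?thesis by (auto simp: cluster_def lifted_def)
  qed
  moreover have "lifted C\<^sup>t V U"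
    using time.lifted_sym UV ultrafilter_closed U V by blast
  ultimately show ?thesis using U V UV by blast
qed

text \<open>\<open>time_prec\<close> enlarges \<open>U\<close> to its cluster, and
  \<open>prec_time\<close> then does so for \<open>V\<close>. Conditions on the precedence of
  clusters can hence be checked on ultrafilters.\<close>

lemma precedes_cluster_iff:
  assumes U: "ultrafilter U" and V: "ultrafilter V"
  shows "precedes (cluster U) (cluster V) \<longleftrightarrow> precedes U V"
proof
  show "precedes U V" if "precedes (cluster U) (cluster V)"
    using that subset_cluster[OF U] subset_cluster[OF V] unfolding lifted_def by blast
next
  assume UV: "precedes U V"
  have cl: "V \<subseteq> carrier A" using V ultrafilter_closed by blast
  have UV': "precedes (cluster U) V"
    by (rule lifted_trans[OF U cluster_closed cl time_prec lifted_cluster UV])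
  show "precedes (cluster U) (cluster V)"
    by (rule lifted_trans[OF V cluster_closed cluster_closed prec_time UV'
      time.lifted_sym[OF cluster_closed cl lifted_cluster]])
qed

lemma ball_clusters: "(\<forall>\<Gamma>\<in>clusters. P \<Gamma>) \<longleftrightarrow> (\<forall>U. ultrafilter U \<longrightarrow> P (cluster U))"
  by (auto simp: clusters_def)

lemma bex_clusters: "(\<exists>\<Gamma>\<in>clusters. P \<Gamma>) \<longleftrightarrow> (\<exists>U. ultrafilter U \<and> P (cluster U))"
  by (auto simp: clusters_def)

text \<open>Where the condition asks for an instant, the axiom yields the separation hypothesis of
  \<open>common_ultrafilter\<close>; the converse of \<open>\<B>\<close> enters where the new
  instant comes first. Results for ultrafilters carry over by
  \<open>precedes_cluster_iff\<close>.\<close>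

lemma holds_in_imp_time_condition:
  assumes "holds_in \<alpha> A"
  shows "time_condition \<alpha> clusters precedes"
proof -
  note base = ultrafilter_meet_base
  note conv = prec.precontact_converse
  note pre = prec.precontact_algebra_axioms
  have cl: "a \<in> carrier A" if "ultrafilter U" "a \<in> U" for a U
    using that by (rule ultrafilter_closed)
  have nz: "a \<noteq> \<^bold>0" if "ultrafilter U" "a \<in> U" for a U
    using that ultrafilter_simps(1) by blast
  have meet: "a \<^bold>\<cdot> b \<in> U" if "ultrafilter U" "a \<in> U" "b \<in> U" for a b U
    using that cl by simp
  have B_mono: "\<B> a c" if "\<B> a' c'" "a' \<^bold>\<le> a" "c' \<^bold>\<le> c" 
    "a \<in> carrier A" "c \<in> carrier A" "a' \<in> carrier A" "c' \<in> carrier A" for a a' c c'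
    using prec.upward[of a' c' a c] that by blast
  have conv_lifted: "lifted (\<lambda>a b. \<B> b a) U V \<longleftrightarrow> precedes V U" for U V
    by (auto simp: lifted_def)
  show ?thesis
  proof (cases \<alpha>)
    case RS
    have "\<exists>V. ultrafilter V \<and> precedes U V" if U: "ultrafilter U" for U
    proof -
      \<comment> \<open>The axiom speaks of the unit. Applied to the meet of \<open>a\<close> and
        \<open>b\<close>, with the unit split into \<open>p\<close> and its complement, it gives the
        disjunction by additivity and monotonicity.\<close>
      have "\<B> a p \<or> \<B> b (\<^bold>- p)" if ab: "a \<in> U" "b \<in> U" and p: "p \<in> carrier A" for a b p
      proof -
        have c: "a \<in> carrier A" "b \<in> carrier A" using ab cl U by auto
        have "\<B> (a \<^bold>\<cdot> b) (p \<^bold>+ \<^bold>- p)"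
          using assms RS nz[OF U meet[OF U ab]] c p by (simp add: join_compl)
        then have "\<B> (a \<^bold>\<cdot> b) p \<or> \<B> (a \<^bold>\<cdot> b) (\<^bold>- p)" using prec.right_additive c p by simp
        then show ?thesis
          using B_mono[OF _ meet_leI(1) prec.ble_refl] B_mono[OF _ meet_leI(2) prec.ble_refl] c p
          by (metis closed(4,5))
      qed
      then show ?thesis using common_ultrafilter[OF pre pre base[OF U] base[OF U]] by blast
    qed
    then show ?thesis
      by (simp add: RS ball_clusters bex_clusters precedes_cluster_iff cong: conj_cong)
  next
    case LS
    have "\<exists>V. ultrafilter V \<and> precedes V U" if U: "ultrafilter U" for U
    proof -
      have "\<B> p a \<or> \<B> (\<^bold>- p) b" if ab: "a \<in> U" "b \<in> U" and p: "p \<in> carrier A" for a b p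
      proof -
        have c: "a \<in> carrier A" "b \<in> carrier A" using ab cl U by auto
        have "\<B> (p \<^bold>+ \<^bold>- p) (a \<^bold>\<cdot> b)"
          using assms LS nz[OF U meet[OF U ab]] c p by (simp add: join_compl)
        then have "\<B> p (a \<^bold>\<cdot> b) \<or> \<B> (\<^bold>- p) (a \<^bold>\<cdot> b)" using prec.left_additive c p by simp
        then show ?thesis
          using B_mono[OF _ prec.ble_refl meet_leI(1)] B_mono[OF _ prec.ble_refl meet_leI(2)] c p
          by (metis closed(4,5))
      qed
      then show ?thesis
        using common_ultrafilter[OF conv conv base[OF U] base[OF U]] conv_lifted by blast
    qed
    then show ?thesis
      by (simp add: LS ball_clusters bex_clusters precedes_cluster_iff cong: conj_cong)
  next
    case UpDir
    have "\<exists>W. ultrafilter W \<and> precedes U W \<and> precedes V W" if U: "ultrafilter U" and V: "ultrafilter V" for U V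
    proof (rule common_ultrafilter[OF pre pre base[OF U] base[OF V]])
      show "\<B> a p \<or> \<B> b (\<^bold>- p)" if "a \<in> U" "b \<in> V" "p \<in> carrier A" for a b p
        using assms UpDir that cl[OF U] cl[OF V] nz[OF U] nz[OF V] by simp
    qed
    then show ?thesis
      by (simp add: UpDir ball_clusters bex_clusters precedes_cluster_iff cong: conj_cong)
  next
    case DownDir
    have "\<exists>W. ultrafilter W \<and> precedes W U \<and> precedes W V" if U: "ultrafilter U" and V: "ultrafilter V" for U V
      unfolding conv_lifted[symmetric]
    proof (rule common_ultrafilter[OF conv conv base[OF U] base[OF V]])
      show "\<B> p a \<or> \<B> (\<^bold>- p) b" if "a \<in> U" "b \<in> V" "p \<in> carrier A" for a b p
        using assms DownDir that cl[OF U] cl[OF V] nz[OF U] nz[OF V] by simp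
    qed
    then show ?thesis
      by (simp add: DownDir ball_clusters bex_clusters precedes_cluster_iff cong: conj_cong)
  next
    case Circ
    have "\<exists>W. ultrafilter W \<and> precedes V W \<and> precedes W U"
      if U: "ultrafilter U" and V: "ultrafilter V" and UV: "precedes U V" for U V
      unfolding conv_lifted[of U, symmetric]
    proof (rule common_ultrafilter[OF pre conv base[OF V] base[OF U]])
      show "\<B> b p \<or> \<B> (\<^bold>- p) a" if "b \<in> V" "a \<in> U" "p \<in> carrier A" for a b p
        using assms Circ that cl[OF U] cl[OF V] UV by (simp add: lifted_def)
    qed
    then show ?thesis
      by (simp add: Circ ball_clusters bex_clusters precedes_cluster_iff cong: conj_cong)
  next
    case Dens
    have "\<exists>W. ultrafilter W \<and> precedes U W \<and> precedes W V"
      if U: "ultrafilter U" and V: "ultrafilter V" and UV: "precedes U V" for U V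
      unfolding conv_lifted[of V, symmetric]
    proof (rule common_ultrafilter[OF pre conv base[OF U] base[OF V]])
      show "\<B> a p \<or> \<B> (\<^bold>- p) b" if "a \<in> U" "b \<in> V" "p \<in> carrier A" for a b p
        using assms Dens that cl[OF U] cl[OF V] UV by (simp add: lifted_def)
    qed
    then show ?thesis
      by (simp add: Dens ball_clusters bex_clusters precedes_cluster_iff cong: conj_cong)
  next
    case Ref
    have "precedes U U" if U: "ultrafilter U" for U
      using time.lifted_refl[OF U] assms Ref cl[OF U] by (simp add: lifted_def)
    then show ?thesis
      by (simp add: Ref ball_clusters bex_clusters precedes_cluster_iff cong: conj_cong)
  next
    case Lin
    have "precedes U V \<or> precedes V U" if U: "ultrafilter U" and V: "ultrafilter V" for U V
    proof (rule ccontr)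
      assume "\<not> ?thesis"
      \<comment> \<open>The meets of the witnesses in \<open>U\<close> and in \<open>V\<close> are
        nonzero and refute the axiom, since precedence passes up from them.\<close>
      then obtain a b a' b' where ab: "a \<in> U" "b \<in> V" "\<not> \<B> a b" "a' \<in> U" "b' \<in> V" "\<not> \<B> b' a'"
        unfolding lifted_def by blast
      then have c: "a \<in> carrier A" "b \<in> carrier A" "a' \<in> carrier A" "b' \<in> carrier A"
        using cl U V by auto
      have "\<B> (a \<^bold>\<cdot> a') (b \<^bold>\<cdot> b') \<or> \<B> (b \<^bold>\<cdot> b') (a \<^bold>\<cdot> a')"
        using assms Lin nz[OF U meet[OF U ab(1,4)]] nz[OF V meet[OF V ab(2,5)]] c by simp
      then show False
        using ab c B_mono[OF _ meet_leI(1) meet_leI(1)] B_mono[OF _ meet_leI(2) meet_leI(2)] by blast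
    qed
    then show ?thesis
      by (simp add: Lin ball_clusters bex_clusters precedes_cluster_iff cong: conj_cong)
  next
    case Tri
    \<comment> \<open>Equality of instants is first time contact of ultrafilters;
      \<open>cluster_eq\<close> turns it into equality of clusters.\<close>
    have "lifted C\<^sup>t U V \<or> precedes U V \<or> precedes V U"
      if U: "ultrafilter U" and V: "ultrafilter V" for U V
    proof (rule ccontr)
      assume "\<not> ?thesis"
      then obtain a b a' b' a'' b'' where ab: "a \<in> U" "b \<in> V" "\<not> \<B> a b" "a' \<in> U" "b' \<in> V" "\<not> \<B> b' a'"
        "a'' \<in> U" "b'' \<in> V" "\<not> C\<^sup>t a'' b''"
        unfolding lifted_def by blast
      then have c: "a \<in> carrier A" "b \<in> carrier A" "a' \<in> carrier A" "b' \<in> carrier A"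
        "a'' \<in> carrier A" "b'' \<in> carrier A" using cl U V by auto
      let ?a = "a \<^bold>\<cdot> a' \<^bold>\<cdot> a''" and ?b = "b \<^bold>\<cdot> b' \<^bold>\<cdot> b''"
      have m: "?a \<in> U" "?b \<in> V" using ab meet U V by auto
      have le: "?a \<^bold>\<le> a" "?a \<^bold>\<le> a'" "?a \<^bold>\<le> a''" "?b \<^bold>\<le> b" "?b \<^bold>\<le> b'" "?b \<^bold>\<le> b''"
        unfolding ble_def using c by (simp_all add: meet_ac meet_left_idem)
      have "C\<^sup>t ?a ?b \<or> \<B> ?a ?b \<or> \<B> ?b ?a"
        using assms Tri nz[OF U m(1)] nz[OF V m(2)] c by simp
      moreover have "\<not> C\<^sup>t ?a ?b"
        using time.upward[of ?a ?b a'' b''] le ab(9) c by auto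
      ultimately show False
        using ab(3,6) c B_mono[OF _ le(1,4)] B_mono[OF _ le(5,2)] by auto
    qed
    then show ?thesis
      unfolding Tri time_condition.simps ball_clusters using precedes_cluster_iff cluster_eq by blast
  next
    case Tr
    \<comment> \<open>The axiom is the separation hypothesis of \<open>lifted_trans\<close> with
      \<open>\<B>\<close> in all three roles.\<close>
    have sep: "\<And>a b. \<lbrakk>a \<in> carrier A; b \<in> carrier A; \<not> \<B> a b\<rbrakk>
        \<Longrightarrow> \<exists>c\<in>carrier A. \<not> \<B> a c \<and> \<not> \<B> (\<^bold>- c) b"
      using assms Tr by simp
    have trans: "precedes U W"
      if "ultrafilter U" "ultrafilter V" "ultrafilter W" "precedes U V" "precedes V W" for U V W
    proof (rule lifted_trans[OF that(2) _ _ sep that(4,5)])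
      show "U \<subseteq> carrier A" "W \<subseteq> carrier A" using cl that(1,3) by auto
    qed
    show ?thesis by (simp add: Tr ball_clusters precedes_cluster_iff) (blast intro: trans)
  qed
qed

text \<open>Without a separating element the criterion puts an ultrafilter \<open>W\<close> after
  \<open>a\<close> and before \<open>b\<close>. Extending \<open>a\<close> and \<open>b\<close> to
  ultrafilters around \<open>W\<close>, transitivity forces \<open>\<B> a b\<close>.\<close>

lemma holds_in_Tr_if_transitive:
  assumes trans: "time_condition Tr clusters precedes"
  shows "holds_in Tr A"
  unfolding holds_in.simps
proof (intro ballI impI, rule ccontr)
  fix a b assume ab: "a \<in> carrier A" "b \<in> carrier A" "\<not> \<B> a b"
    and no: "\<not> (\<exists>c\<in>carrier A. \<not> \<B> a c \<and> \<not> \<B> (\<^bold>- c) b)"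
  interpret conv: precontact_algebra A "\<lambda>a b. \<B> b a" by (rule prec.precontact_converse)
  have base: "meet_base {a}" "meet_base {b}" using ab singleton_meet_base by auto
  have sep: "\<B> x p \<or> \<B> (\<^bold>- p) y" if "x \<in> {a}" "y \<in> {b}" "p \<in> carrier A" for x y p
    using that no by auto
  obtain W where W: "ultrafilter W" "lifted \<B> {a} W" "lifted (\<lambda>a b. \<B> b a) {b} W"
    using common_ultrafilter[OF prec.precontact_algebra_axioms prec.precontact_converse base sep] by blast
  \<comment> \<open>Turned around so that \<open>W\<close> is the fixed base while \<open>a\<close>
    and \<open>b\<close> are extended.\<close>
  have "lifted \<B> W {b}" "lifted (\<lambda>a b. \<B> b a) W {a}" using W(2,3) by (auto simp: lifted_def)
  then obtain U V where UV: "ultrafilter U" "{a} \<subseteq> U" "lifted (\<lambda>a b. \<B> b a) W U"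
    "ultrafilter V" "{b} \<subseteq> V" "precedes W V"
    using conv.extend_right[OF ultrafilter_meet_base[OF W(1)] base(1)]
      prec.extend_right[OF ultrafilter_meet_base[OF W(1)] base(2)] by blast
  then have "precedes U W" by (auto simp: lifted_def)
  then have "precedes (cluster U) (cluster W)" "precedes (cluster W) (cluster V)"
    using UV W(1) precedes_cluster_iff by auto
  then have "precedes (cluster U) (cluster V)"
    using trans UV(1,4) W(1) unfolding time_condition.simps clusters_def by blast
  then have "precedes U V" using UV(1,4) precedes_cluster_iff by blast
  then show False using UV(2,5) ab(3) by (auto simp: lifted_def)
qed

section \<open>Snapshots at the clusters and the embedding into their product\<close>

abbreviation snapshot_algebra :: "'a set \<Rightarrow> 'a set bool_alg"
  where "snapshot_algebra \<Gamma> \<equiv> quotient_alg (points \<Gamma>)"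

abbreviation snapshot_contact :: "'a set \<Rightarrow> 'a set \<Rightarrow> 'a set \<Rightarrow> bool"
  where "snapshot_contact \<Gamma> \<equiv> quotient_contact (points \<Gamma>) (lifted C\<^sup>s)"

lemma snapshot_zero_iff: "a \<in> carrier A \<Longrightarrow>
    trace (points \<Gamma>) a = \<^bold>0\<^bsub>snapshot_algebra \<Gamma>\<^esub> \<longleftrightarrow> (\<forall>U\<in>points \<Gamma>. a \<notin> U)"
  using trace_eq_zero_iff[OF points_ultrafilter] by (simp add: quotient_alg_def)

text \<open>A generating ultrafilter is a point of its own cluster, so the unit of the factor is not
  zero. Clusters exist because \<open>A\<close> is nondegenerate.\<close>

lemma full_standard_snapshots:
  "full_standard clusters snapshot_algebra snapshot_contact"
proof (rule full_standard.intro)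
  fix \<Gamma> assume "\<Gamma> \<in> clusters"
  then obtain U where U: "ultrafilter U" "\<Gamma> = cluster U" by (auto simp: clusters_def)
  show "contact_algebra (snapshot_algebra \<Gamma>) (snapshot_contact \<Gamma>)"
  proof (rule contact_algebra_quotient[OF points_ultrafilter])
    show "lifted C\<^sup>s V V" if "V \<in> points \<Gamma>" for V
      using that points_ultrafilter space.lifted_refl by blast
    show "lifted C\<^sup>s W V" if "V \<in> points \<Gamma>" "W \<in> points \<Gamma>" "lifted C\<^sup>s V W" for V W
      using that space.lifted_sym[of V W] points_ultrafilter ultrafilter_closed by blast
  qed
  have one: "\<^bold>1\<^bsub>snapshot_algebra \<Gamma>\<^esub> = trace (points \<Gamma>) \<^bold>1" by (simp add: quotient_alg_def)
  have "U \<in> points \<Gamma>" "\<^bold>1 \<in> U"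
    using self_in_points[OF U(1)] U(2) ultrafilter_simps(2)[OF U(1)] by blast+
  then have "trace (points \<Gamma>) \<^bold>1 \<noteq> \<^bold>0\<^bsub>snapshot_algebra \<Gamma>\<^esub>"
    unfolding snapshot_zero_iff[OF one_closed] by blast
  then show "\<^bold>0\<^bsub>snapshot_algebra \<Gamma>\<^esub> \<noteq> \<^bold>1\<^bsub>snapshot_algebra \<Gamma>\<^esub>" unfolding one by (rule not_sym)
next
  show "clusters \<noteq> {}"
    using ultrafilter_containing[OF one_closed nondegenerate[symmetric]] by (auto simp: clusters_def)
qed

sublocale snapshot: full_standard clusters precedes snapshot_algebra snapshot_contact
  by (rule full_standard_snapshots)

definition snapshots :: "'a \<Rightarrow> 'a set \<Rightarrow> 'a set"
  where "snapshots a = (\<lambda>\<Gamma>\<in>clusters. trace (points \<Gamma>) a)"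

lemma supp_snapshots:
  "a \<in> carrier A \<Longrightarrow> snapshot.supp (snapshots a) = {\<Gamma> \<in> clusters. \<exists>U\<in>points \<Gamma>. a \<in> U}"
  using snapshot_zero_iff by (auto simp: snapshot.supp_def snapshots_def)

lemma boolean_hom_snapshots: "boolean_hom snapshots A snapshot.D"
proof -
  have hom: "trace (points \<Gamma>) \<^bold>0 = \<^bold>0\<^bsub>snapshot_algebra \<Gamma>\<^esub>"
    "trace (points \<Gamma>) \<^bold>1 = \<^bold>1\<^bsub>snapshot_algebra \<Gamma>\<^esub>"
    "\<And>a. a \<in> carrier A \<Longrightarrow> trace (points \<Gamma>) a \<in> carrier (snapshot_algebra \<Gamma>)"
    "\<And>a b. \<lbrakk>a \<in> carrier A; b \<in> carrier A\<rbrakk> \<Longrightarrow>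
      trace (points \<Gamma>) (a \<^bold>+ b) = trace (points \<Gamma>) a \<^bold>+\<^bsub>snapshot_algebra \<Gamma>\<^esub> trace (points \<Gamma>) b"
    "\<And>a b. \<lbrakk>a \<in> carrier A; b \<in> carrier A\<rbrakk> \<Longrightarrow>
      trace (points \<Gamma>) (a \<^bold>\<cdot> b) = trace (points \<Gamma>) a \<^bold>\<cdot>\<^bsub>snapshot_algebra \<Gamma>\<^esub> trace (points \<Gamma>) b"
    "\<And>a. a \<in> carrier A \<Longrightarrow>
      trace (points \<Gamma>) (\<^bold>- a) = \<^bold>-\<^bsub>snapshot_algebra \<Gamma>\<^esub> trace (points \<Gamma>) a" for \<Gamma>
    using boolean_hom_trace[OF points_ultrafilter, of \<Gamma>] by (auto simp: boolean_hom_def)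
  show ?thesis
    by (auto simp: boolean_hom_def snapshots_def hom intro!: restrict_ext)
qed

text \<open>Every ultrafilter \<open>U\<close> is a point of \<open>cluster U\<close>, so the
  coordinate there determines whether \<open>a\<close> is in \<open>U\<close>.\<close>

lemma inj_on_snapshots: "inj_on snapshots (carrier A)"
proof (rule inj_onI)
  fix a b assume ab: "a \<in> carrier A" "b \<in> carrier A" "snapshots a = snapshots b"
  have "a \<in> U \<longleftrightarrow> b \<in> U" if U: "ultrafilter U" for U
  proof -
    have "cluster U \<in> clusters" using U by (auto simp: clusters_def)
    then have "trace (points (cluster U)) a = trace (points (cluster U)) b"
      using fun_cong[OF ab(3), of "cluster U"] by (simp add: snapshots_def)
    then show ?thesis
      using meets_trace_iff[OF self_in_points[OF U]] ab(1,2) by metis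
  qed
  then show "a = b" using eq_iff_ultrafilters ab(1,2) by blast
qed

text \<open>The pairs of ultrafilters that represent a relation are matched with pairs of points: of
  one cluster for the two contacts, of two clusters for the precedence.\<close>

lemma dca_embedding_snapshots: "dca_embedding snapshots A snapshot.D"
  unfolding dca_embedding_def
proof (intro conjI ballI boolean_hom_snapshots inj_on_snapshots)
  fix a b assume a: "a \<in> carrier A" and b: "b \<in> carrier A"
  have cluster: "cluster U \<in> clusters" if "ultrafilter U" for U
    using that by (auto simp: clusters_def)
  have point: "ultrafilter U" "U \<subseteq> \<Gamma>" if "U \<in> points \<Gamma>" for U \<Gamma>
    using that by (auto simp: points_def)
  show "C\<^sup>s a b \<longleftrightarrow> C\<^sup>s\<^bsub>snapshot.D\<^esub> (snapshots a) (snapshots b)"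
  proof -
    have "C\<^sup>s\<^bsub>snapshot.D\<^esub> (snapshots a) (snapshots b) \<longleftrightarrow>
        (\<exists>\<Gamma>\<in>clusters. \<exists>U\<in>points \<Gamma>. \<exists>V\<in>points \<Gamma>. lifted C\<^sup>s U V \<and> a \<in> U \<and> b \<in> V)"
      by (simp add: snapshots_def quotient_contact_trace[OF a b] del: bex_simps)
    also have "\<dots> \<longleftrightarrow> (\<exists>U V. ultrafilter U \<and> ultrafilter V \<and> lifted C\<^sup>s U V \<and> a \<in> U \<and> b \<in> V)"
    proof
      assume "\<exists>U V. ultrafilter U \<and> ultrafilter V \<and> lifted C\<^sup>s U V \<and> a \<in> U \<and> b \<in> V"
      then obtain U V where UV: "ultrafilter U" "ultrafilter V" "lifted C\<^sup>s U V" "a \<in> U" "b \<in> V"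
        by blast
      \<comment> \<open>Space contact implies time contact, which places both ultrafilters in one
        cluster, where the contact of the factor can relate them.\<close>
      then have "lifted C\<^sup>t U V"
        unfolding lifted_def using space_imp_time ultrafilter_closed by blast
      then have "U \<in> points (cluster V)" using points_cluster_iff UV by blast
      then show "\<exists>\<Gamma>\<in>clusters. \<exists>U\<in>points \<Gamma>. \<exists>V\<in>points \<Gamma>. lifted C\<^sup>s U V \<and> a \<in> U \<and> b \<in> V"
        using UV cluster self_in_points by blast
    qed (use point in blast)
    finally show ?thesis using space.related_iff_ultrafilters[OF a b] by simp
  qed
  show "C\<^sup>t a b \<longleftrightarrow> C\<^sup>t\<^bsub>snapshot.D\<^esub> (snapshots a) (snapshots b)"
    unfolding snapshot.time_iff supp_snapshots[OF a] supp_snapshots[OF b]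
  proof
    assume "C\<^sup>t a b"
    then obtain U V where UV: "ultrafilter U" "ultrafilter V" "lifted C\<^sup>t U V" "a \<in> U" "b \<in> V"
      using time.related_iff_ultrafilters[OF a b] by blast
    then have "U \<in> points (cluster V)" using points_cluster_iff by blast
    then show "{\<Gamma> \<in> clusters. \<exists>U\<in>points \<Gamma>. a \<in> U} \<inter> {\<Gamma> \<in> clusters. \<exists>U\<in>points \<Gamma>. b \<in> U} \<noteq> {}"
      using UV cluster self_in_points by blast
  next
    assume "{\<Gamma> \<in> clusters. \<exists>U\<in>points \<Gamma>. a \<in> U} \<inter> {\<Gamma> \<in> clusters. \<exists>U\<in>points \<Gamma>. b \<in> U} \<noteq> {}"
    then obtain W U V where W: "ultrafilter W" and UV: "U \<in> points (cluster W)" "V \<in> points (cluster W)"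
      "a \<in> U" "b \<in> V" by (auto simp: clusters_def)
    have cl: "U \<subseteq> carrier A" "V \<subseteq> carrier A" "W \<subseteq> carrier A"
      using UV(1,2) W point ultrafilter_closed by blast+
    \<comment> \<open>Two points of \<open>cluster W\<close> are linked through \<open>W\<close>,
      and the Efremovich axiom composes the two contacts.\<close>
    have UWV: "lifted C\<^sup>t U W" "lifted C\<^sup>t W V"
      using UV points_cluster_iff[OF W] time.lifted_sym cl by auto
    have "lifted C\<^sup>t U V" by (rule lifted_trans[OF W cl(1,2) time_efremovich UWV])
    then show "C\<^sup>t a b" using UV(3,4) by (simp add: lifted_def)
  qed
  show "\<B> a b \<longleftrightarrow> \<B>\<^bsub>snapshot.D\<^esub> (snapshots a) (snapshots b)"
    unfolding snapshot.prec_iff supp_snapshots[OF a] supp_snapshots[OF b]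
  proof
    assume "\<B> a b"
    then obtain U V where UV: "ultrafilter U" "ultrafilter V" "precedes U V" "a \<in> U" "b \<in> V"
      using prec.related_iff_ultrafilters[OF a b] by blast
    then have "precedes (cluster U) (cluster V)" using precedes_cluster_iff by blast
    then show "\<exists>\<Gamma>\<in>{\<Gamma> \<in> clusters. \<exists>U\<in>points \<Gamma>. a \<in> U}. \<exists>\<Delta>\<in>{\<Gamma> \<in> clusters. \<exists>U\<in>points \<Gamma>. b \<in> U}. precedes \<Gamma> \<Delta>"
      using UV cluster self_in_points by blast
  next
    assume "\<exists>\<Gamma>\<in>{\<Gamma> \<in> clusters. \<exists>U\<in>points \<Gamma>. a \<in> U}. \<exists>\<Delta>\<in>{\<Gamma> \<in> clusters. \<exists>U\<in>points \<Gamma>. b \<in> U}. precedes \<Gamma> \<Delta>"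
    \<comment> \<open>Precedence of clusters concerns all their elements, so it applies to
      \<open>a\<close> and \<open>b\<close> directly.\<close>
    then obtain \<Gamma> \<Delta> where "a \<in> \<Gamma>" "b \<in> \<Delta>" "precedes \<Gamma> \<Delta>" using point(2) by blast
    then show "\<B> a b" by (simp add: lifted_def)
  qed
qed

end

theorem theorem4p15:
  fixes A :: "'a dca"
  assumes "dynamic_contact_algebra A"
  shows "\<exists>(T :: 'a set set) (before :: 'a set \<Rightarrow> 'a set \<Rightarrow> bool)
            (Bs :: 'a set \<Rightarrow> 'a set bool_alg) (Cs :: 'a set \<Rightarrow> 'a set \<Rightarrow> 'a set \<Rightarrow> bool)
            (h :: 'a \<Rightarrow> 'a set \<Rightarrow> 'a set).
          (\<forall>i\<in>T. contact_algebra (Bs i) (Cs i)) \<and>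
          dynamic_contact_algebra (full_standard_dca T before Bs Cs) \<and>
          dca_embedding h A (full_standard_dca T before Bs Cs) \<and>
          (\<forall>\<alpha>. holds_in \<alpha> A \<longleftrightarrow> holds_in \<alpha> (full_standard_dca T before Bs Cs))"
proof -
  interpret dynamic_contact_algebra A by (rule assms)
  \<comment> \<open>Forwards, every axiom passes through the conditions on clusters. Backwards, the
    embedding reflects the universal axioms, and \<open>Tr\<close> returns through transitivity of
    the precedence.\<close>
  have axioms_iff: "holds_in \<alpha> A \<longleftrightarrow> holds_in \<alpha> snapshot.D" for \<alpha>
  proof
    show "holds_in \<alpha> snapshot.D" if "holds_in \<alpha> A"
      using that holds_in_imp_time_condition snapshot.time_condition_imp_holds_in by blast
    show "holds_in \<alpha> A" if "holds_in \<alpha> snapshot.D"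
      using that holds_in_reflected[OF assms dca_embedding_snapshots, of \<alpha>]
        holds_in_Tr_if_transitive snapshot.transitive_if_holds_in by blast
  qed
  show ?thesis
    by (intro exI conjI ballI allI) (rule snapshot.factor snapshot.dynamic_contact_algebra_D
      dca_embedding_snapshots axioms_iff; assumption?)+
qed

end
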